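(* Let $\lambda\in\varrho(H_0)$, i.e. $\mathfrak D(\lambda)\notin[-2,2]$. Then $$((H_0-\lambda)^{-1}f)(x)=\int_{\mathbb R}G(x,t,\lambda)\,f(t)\,dt\qquad(x\in\mathbb R;\ f\in L^2(\mathbb R)^2)$$ with the (matrix-valued) Green's function $$G(x,t,\lambda)=-\frac{e^{ik(\lambda)|t-x|}}{\det(v_+(\lambda),v_-(\lambda))}\begin{cases}\varphi_+(x,\lambda)\,\varphi_-(t,\lambda)^T&\text{if }t>x,\\ \varphi_-(x,\lambda)\,\varphi_+(t,\lambda)^T&\text{if }t<x\end{cases}\qquad(x,t\in\mathbb R).$$ For all $x,t\in\mathbb R$, $x\ne t$, the Frobenius norm of the matrix $G(x,t,\lambda)$ is $$\|G(x,t,\lambda)\|_F=\frac{e^{-\operatorname{Im}k(\lambda)|t-x|}}{|\det(v_+(\lambda),v_-(\lambda))|}\begin{cases}|\varphi_+(x,\lambda)|\,|\varphi_-(t,\lambda)|&\text{if }t>x,\\ |\varphi_-(x,\lambda)|\,|\varphi_+(t,\lambda)|&\text{if }t<x.\end{cases}$$ Moreover, for any $r\in(1,2]$ with conjugate exponent $r'=1/(1-\frac1r)\ge2$, the integral operator $R_r(\lambda):L^r(\mathbb R)^2\to L^{r'}(\mathbb R)^2$, $$(R_r(\lambda)f)(x)=\int_{\mathbb R}G(x,t,\lambda)\,f(t)\,dt\qquad(x\in\mathbb R;\ f\in L^r(\mathbb R)^2),$$ is a bounded linear operator with operator norm $$\|R_r(\lambda)\|\le C(\lambda)\left(\frac{4}{r'\operatorname{Im}k(\lambda)}\right)^{\frac2{r'}},\qquad\text{where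 } C(\lambda):=\frac{\|\varphi_+(\cdot,\lambda)\|_\infty\,\|\varphi_-(\cdot,\lambda)\|_\infty}{|\det(v_+(\lambda),v_-(\lambda))|}.$$
   Context: Setting: $m\ge0$, $a>0$, and $q:\mathbb R\to\mathbb R$ is locally integrable and $a$-periodic. Pauli matrices: $\sigma_2=\begin{pmatrix}0&-i\\i&0\end{pmatrix}$, $\sigma_3=\begin{pmatrix}1&0\\0&-1\end{pmatrix}$; $\mathbb I$ is the $2\times2$ unit matrix. $|w|=\sqrt{|w_1|^2+|w_2|^2}$ for $w\in\mathbb C^2$, and $\|\varphi\|_\infty=\sup_{x\in\mathbb R}|\varphi(x)|$ for $\mathbb C^2$-valued functions. $H_0=-i\sigma_2\frac d{dx}+m\sigma_3+q$ is the self-adjoint operator in $L^2(\mathbb R)^2$ (on its maximal domain), with resolvent set $\varrho(H_0)$. For $\lambda\in\mathbb C$, $\Phi(\cdot,\lambda)$ is the canonical fundamental system: the $2\times2$ matrix solution of $-i\sigma_2\Phi'(x,\lambda)+(m\sigma_3+q(x))\Phi(x,\lambda)=\lambda\Phi(x,\lambda)$ $(x\in\mathbb R)$, $\Phi(0,\lambda)=\mathbb I$. The monodromy matrix is $M(\lambda)=\Phi(a,\lambda)$ (of determinant 1), the discriminant is $\mathfrak D(\lambda)=\operatorname{Tr}M(\lambda)$. The spectrum of $H_0$ is $\{\lambda\in\mathbb C\mid\mathfrak D(\lambda)\in[-2,2]\}\subset\mathbb R$. Quasimomentum: on $\{\operatorname{Im}\lambda\ge0\}$, $k$ is a continuous function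 with $\mathfrak D(\lambda)=2\cos(k(\lambda)a)$ and $\operatorname{Im}k(\lambda)\ge0$; for $\operatorname{Im}\lambda<0$, $k(\lambda):=-\overline{k(\overline\lambda)}$. If $\mathfrak D(\lambda)\notin[-2,2]$, the eigenvalues of $M(\lambda)$ are $\rho(\lambda)=e^{-ik(\lambda)a}$ (outside the unit circle) and $1/\rho(\lambda)=e^{ik(\lambda)a}$ (inside the unit circle); $v_+(\lambda),v_-(\lambda)\in\mathbb C^2\setminus\{0\}$ denote corresponding eigenvectors, respectively, and $\det(v_+,v_-)$ is the determinant of the matrix with these columns. Floquet solutions: $u_\pm(x,\lambda)=\Phi(x,\lambda)v_\pm(\lambda)$; the functions $\varphi_\pm(x,\lambda)=e^{\pm ik(\lambda)x}u_\pm(x,\lambda)$ are $a$-periodic in $x$, with $\varphi_\pm(0,\lambda)=v_\pm(\lambda)$. *)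

theory Defs
  imports "HOL-Analysis.Analysis"
begin

section \<open>Lebesgue spaces and operators between them\<close>

text \<open>
  Elements of \<open>L\<^sup>p(\<real>)\<^sup>2\<close> are represented by functions; the passage to classes modulo null sets is made
  explicit where it matters. On \<open>complex ^ 2\<close> the library norm is the Euclidean norm.
\<close>

definition Lp_space :: "real \<Rightarrow> (real \<Rightarrow> complex ^ 2) set" where
  "Lp_space p =
    {f. f \<in> borel_measurable lebesgue \<and> integrable lebesgue (\<lambda>x. norm (f x) powr p)}"

definition Lp_norm :: "real \<Rightarrow> (real \<Rightarrow> complex ^ 2) \<Rightarrow> real" where
  "Lp_norm p f = (LINT x|lebesgue. norm (f x) powr p) powr (1 / p)"

text \<open>The first two clauses say that \<open>T\<close> induces a map between the spaces of classes.\<close>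

definition Lp_bounded_linear ::
    "real \<Rightarrow> real \<Rightarrow> ((real \<Rightarrow> complex ^ 2) \<Rightarrow> (real \<Rightarrow> complex ^ 2)) \<Rightarrow> bool" where
  "Lp_bounded_linear r s T \<longleftrightarrow>
    (\<forall>f \<in> Lp_space r. T f \<in> Lp_space s) \<and>
    (\<forall>f \<in> Lp_space r. \<forall>g \<in> Lp_space r.
      (AE x in lebesgue. f x = g x) \<longrightarrow> (AE x in lebesgue. T f x = T g x)) \<and>
    (\<forall>f \<in> Lp_space r. \<forall>g \<in> Lp_space r.
      AE x in lebesgue. T (\<lambda>y. f y + g y) x = T f x + T g x) \<and>
    (\<forall>f \<in> Lp_space r. \<forall>c. AE x in lebesgue. T (\<lambda>y. c *s f y) x = c *s T f x) \<and>
    (\<exists>C. \<forall>f \<in> Lp_space r. Lp_norm s (T f) \<le> C * Lp_norm r f)"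

text \<open>Meaningful only for bounded operators, since \<open>Sup\<close> on the reals is.\<close>

definition Lp_opnorm ::
    "real \<Rightarrow> real \<Rightarrow> ((real \<Rightarrow> complex ^ 2) \<Rightarrow> (real \<Rightarrow> complex ^ 2)) \<Rightarrow> real" where
  "Lp_opnorm r s T = (SUP f \<in> {f \<in> Lp_space r. Lp_norm r f \<le> 1}. Lp_norm s (T f))"


section \<open>The periodic Dirac operator\<close>

definition sigma2 :: "complex ^ 2 ^ 2" where
  "sigma2 = vector [vector [0, - \<i>], vector [\<i>, 0]]"

definition sigma3 :: "complex ^ 2 ^ 2" where
  "sigma3 = vector [vector [1, 0], vector [0, - 1]]"

definition locally_integrable :: "(real \<Rightarrow> 'a::euclidean_space) \<Rightarrow> bool" where
  "locally_integrable f \<longleftrightarrow> (\<forall>x y. f absolutely_integrable_on {x..y})"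

text \<open>
  \<open>u\<close> is locally absolutely continuous with derivative \<open>u'\<close>: it is an indefinite Lebesgue integral of the
  locally integrable function \<open>u'\<close>. This determines \<open>u'\<close> up to a null set.
\<close>

definition has_ac_derivative ::
    "(real \<Rightarrow> 'a::euclidean_space) \<Rightarrow> (real \<Rightarrow> 'a) \<Rightarrow> bool" where
  "has_ac_derivative u u' \<longleftrightarrow>
    locally_integrable u' \<and> (\<forall>x y. x \<le> y \<longrightarrow> u y - u x = (LINT t:{x..y}|lebesgue. u' t))"

definition dirac_potential :: "real \<Rightarrow> (real \<Rightarrow> real) \<Rightarrow> real \<Rightarrow> complex ^ 2 ^ 2" where
  "dirac_potential m q x = m *\<^sub>R sigma3 + q x *\<^sub>R mat 1"

text \<open>
  The operator \<open>H\<^sub>0\<close> on its maximal domain, as a graph of pairs \<open>(u, H\<^sub>0 u)\<close>. In the first component each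
  class is represented by its unique locally absolutely continuous representative; the second
  component is closed under almost everywhere equality.
\<close>

definition dirac_graph ::
    "real \<Rightarrow> (real \<Rightarrow> real) \<Rightarrow> ((real \<Rightarrow> complex ^ 2) \<times> (real \<Rightarrow> complex ^ 2)) set" where
  "dirac_graph m q =
    {(u, f). u \<in> Lp_space 2 \<and> f \<in> Lp_space 2 \<and>
      (\<exists>u'. has_ac_derivative u u' \<and>
        (AE x in lebesgue. (- \<i>) *s (sigma2 *v u' x) + dirac_potential m q x *v u x = f x))}"

text \<open>
  For an operator with graph \<open>T\<close>, \<open>(T - z) u = f\<close> reads \<open>(u, f + z u) \<in> T\<close>. Uniqueness of \<open>u\<close> is meant
  literally, as is appropriate when the domain consists of distinguished representatives.
\<close>

definition resolvent_set ::
    "((real \<Rightarrow> complex ^ 2) \<times> (real \<Rightarrow> complex ^ 2)) set \<Rightarrow> complex set" where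
  "resolvent_set T =
    {z. (\<forall>f \<in> Lp_space 2. \<exists>!u. (u, \<lambda>x. f x + z *s u x) \<in> T) \<and>
         (\<exists>C. \<forall>f \<in> Lp_space 2. \<forall>u. (u, \<lambda>x. f x + z *s u x) \<in> T \<longrightarrow>
            Lp_norm 2 u \<le> C * Lp_norm 2 f)}"

definition resolvent ::
    "((real \<Rightarrow> complex ^ 2) \<times> (real \<Rightarrow> complex ^ 2)) set \<Rightarrow> complex \<Rightarrow>
      (real \<Rightarrow> complex ^ 2) \<Rightarrow> (real \<Rightarrow> complex ^ 2)" where
  "resolvent T z f = (THE u. (u, \<lambda>x. f x + z *s u x) \<in> T)"


section \<open>Floquet theory\<close>

text \<open>
  The spectral parameter is called \<open>z\<close>. As a factor of a matrix it is written as the scalar matrix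
  \<open>mat z\<close>, and \<open>- \<i>\<close> likewise as \<open>mat (- \<i>)\<close>.
\<close>

definition is_fundamental_system ::
    "real \<Rightarrow> (real \<Rightarrow> real) \<Rightarrow> (real \<Rightarrow> complex \<Rightarrow> complex ^ 2 ^ 2) \<Rightarrow> bool" where
  "is_fundamental_system m q \<Phi> \<longleftrightarrow>
    (\<forall>z. \<Phi> 0 z = mat 1 \<and>
      (\<exists>\<Phi>'. has_ac_derivative (\<lambda>x. \<Phi> x z) \<Phi>' \<and>
        (AE x in lebesgue.
          mat (- \<i>) ** sigma2 ** \<Phi>' x + dirac_potential m q x ** \<Phi> x z = mat z ** \<Phi> x z)))"

definition monodromy ::
    "real \<Rightarrow> (real \<Rightarrow> complex \<Rightarrow> complex ^ 2 ^ 2) \<Rightarrow> complex \<Rightarrow> complex ^ 2 ^ 2" where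
  "monodromy a \<Phi> z = \<Phi> a z"

definition discriminant ::
    "real \<Rightarrow> (real \<Rightarrow> complex \<Rightarrow> complex ^ 2 ^ 2) \<Rightarrow> complex \<Rightarrow> complex" where
  "discriminant a \<Phi> z = trace (monodromy a \<Phi> z)"

definition is_quasimomentum ::
    "real \<Rightarrow> (real \<Rightarrow> complex \<Rightarrow> complex ^ 2 ^ 2) \<Rightarrow> (complex \<Rightarrow> complex) \<Rightarrow> bool" where
  "is_quasimomentum a \<Phi> k \<longleftrightarrow>
    continuous_on {z. Im z \<ge> 0} k \<and>
    (\<forall>z. Im z \<ge> 0 \<longrightarrow> discriminant a \<Phi> z = 2 * cos (k z * of_real a) \<and> Im (k z) \<ge> 0) \<and>
    (\<forall>z. Im z < 0 \<longrightarrow> k z = - cnj (k (cnj z)))"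

definition is_eigenvector :: "complex ^ 2 ^ 2 \<Rightarrow> complex \<Rightarrow> complex ^ 2 \<Rightarrow> bool" where
  "is_eigenvector A \<mu> v \<longleftrightarrow> v \<noteq> 0 \<and> A *v v = \<mu> *s v"

definition det_columns :: "complex ^ 2 \<Rightarrow> complex ^ 2 \<Rightarrow> complex" where
  "det_columns v w = det (transpose (vector [v, w]) :: complex ^ 2 ^ 2)"

definition phi_plus ::
    "(real \<Rightarrow> complex \<Rightarrow> complex ^ 2 ^ 2) \<Rightarrow> (complex \<Rightarrow> complex) \<Rightarrow> complex ^ 2 \<Rightarrow>
      real \<Rightarrow> complex \<Rightarrow> complex ^ 2" where
  "phi_plus \<Phi> k v x z = exp (\<i> * k z * of_real x) *s (\<Phi> x z *v v)"

definition phi_minus ::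
    "(real \<Rightarrow> complex \<Rightarrow> complex ^ 2 ^ 2) \<Rightarrow> (complex \<Rightarrow> complex) \<Rightarrow> complex ^ 2 \<Rightarrow>
      real \<Rightarrow> complex \<Rightarrow> complex ^ 2" where
  "phi_minus \<Phi> k v x z = exp (- \<i> * k z * of_real x) *s (\<Phi> x z *v v)"

definition sup_norm :: "(real \<Rightarrow> complex ^ 2) \<Rightarrow> real" where
  "sup_norm \<phi> = (SUP x. norm (\<phi> x))"

text \<open>The matrix \<open>v w\<^sup>T\<close> (transpose, without complex conjugation).\<close>

definition outer :: "complex ^ 2 \<Rightarrow> complex ^ 2 \<Rightarrow> complex ^ 2 ^ 2" where
  "outer v w = (\<chi> i j. v $ i * w $ j)"

definition frobenius_norm :: "complex ^ 2 ^ 2 \<Rightarrow> real" where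
  "frobenius_norm A = sqrt (\<Sum>i\<in>UNIV. \<Sum>j\<in>UNIV. (cmod (A $ i $ j))\<^sup>2)"

text \<open>The value on the diagonal \<open>t = x\<close>, a null set for each \<open>x\<close>, is immaterial and set to \<open>0\<close>.\<close>

definition green ::
    "(real \<Rightarrow> complex \<Rightarrow> complex ^ 2 ^ 2) \<Rightarrow> (complex \<Rightarrow> complex) \<Rightarrow> complex ^ 2 \<Rightarrow> complex ^ 2 \<Rightarrow>
      real \<Rightarrow> real \<Rightarrow> complex \<Rightarrow> complex ^ 2 ^ 2" where
  "green \<Phi> k vp vm x t z =
    mat (- (exp (\<i> * k z * of_real \<bar>t - x\<bar>) / det_columns vp vm)) **
      (if t > x then outer (phi_plus \<Phi> k vp x z) (phi_minus \<Phi> k vm t z)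
       else if t < x then outer (phi_minus \<Phi> k vm x z) (phi_plus \<Phi> k vp t z)
       else 0)"

definition green_operator ::
    "(real \<Rightarrow> complex \<Rightarrow> complex ^ 2 ^ 2) \<Rightarrow> (complex \<Rightarrow> complex) \<Rightarrow> complex ^ 2 \<Rightarrow> complex ^ 2 \<Rightarrow>
      complex \<Rightarrow> (real \<Rightarrow> complex ^ 2) \<Rightarrow> (real \<Rightarrow> complex ^ 2)" where
  "green_operator \<Phi> k vp vm z f = (\<lambda>x. LINT t|lebesgue. green \<Phi> k vp vm x t z *v f t)"

end

theory Submission
  imports Defs
begin

text \<open>
  Since \<open>det \<Phi> = 1\<close>, the eigenvalues of the monodromy matrix are \<open>\<rho>\<close> and \<open>1 / \<rho>\<close> and its trace is \<open>2 cos (k a)\<close>,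
  so that the discriminant avoids \<open>[-2, 2]\<close> exactly if \<open>Im k > 0\<close>. In this case \<open>u\<^sub>+\<close> decays at \<open>- \<infinity>\<close> and
  \<open>u\<^sub>-\<close> at \<open>+ \<infinity>\<close>; the operator with kernel \<open>G\<close> is variation of constants, and constancy of Wronskians shows
  both that it solves \<open>(H\<^sub>0 - z) u = f\<close> and that the homogeneous equation has no nonzero \<open>L\<^sup>2\<close> solution. The norm
  bounds follow from \<open>\<bar>G(x,t)\<bar> \<le> C exp (- Im k \<bar>t - x\<bar>)\<close> and Young's convolution inequality, with the
  exponential in \<open>L\<^sup>s\<close>, \<open>s = r' / 2\<close>. If \<open>Im k = 0\<close>, a slowly varying cutoff of the bounded solution \<open>u\<^sub>+\<close> violates
  every resolvent bound.
\<close>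

section \<open>Locally absolutely continuous functions\<close>

text \<open>As \<open>q\<close> is only locally integrable, solutions are merely indefinite Lebesgue
  integrals and satisfy the equation almost everywhere. The calculus behind all Wronskian and
  variation-of-constants computations is therefore built on \<open>has_ac_derivative\<close>, and
  its one hard rule, the product rule, is obtained from Fubini's theorem. Uniqueness for the initial
  value problem then comes from Wronskians instead of a Gronwall estimate.

  The exponent \<open>s = r' / 2\<close> is forced by Young's relation
  \<open>1 + 1 / r' = 1 / s + 1 / r\<close> together with \<open>1 / r + 1 / r' = 1\<close>. The
  integral of \<open>exp (- \<kappa> s |x|)\<close> is
  \<open>2 / (\<kappa> s) = 4 / (r' \<kappa>)\<close>, so the \<open>L^s\<close> norm of the
  exponential is exactly the factor \<open>(4 / (r' \<kappa>)) powr (2 / r')\<close> of the claim.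
  For \<open>r = 2\<close> one has \<open>r' = 2\<close>, and the same estimate is the resolvent
  bound in \<open>L^2\<close>.\<close>

lemma lborel_representative_real:
  fixes f :: "real \<Rightarrow> real"
  assumes "f \<in> borel_measurable lebesgue"
  obtains g where "g \<in> borel_measurable lborel" "AE x in lebesgue. f x = g x"
proof -
  obtain g where g: "g \<in> borel_measurable lborel" "AE x in lborel. f x = g x"
    using completion_ex_borel_measurable_real[OF assms] by blast
  show ?thesis
    by (rule that[OF g(1) AE_completion[OF g(2)]])
qed

lemma lborel_representative_complex:
  fixes f :: "real \<Rightarrow> complex"
  assumes "f \<in> borel_measurable lebesgue"
  obtains g where "g \<in> borel_measurable lborel" "AE x in lebesgue. f x = g x"
proof -
  from assms have m: "(\<lambda>x. Re (f x)) \<in> borel_measurable lebesgue" "(\<lambda>x. Im (f x)) \<in> borel_measurable lebesgue"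
    by measurable
  obtain g where g: "g \<in> borel_measurable lborel" "AE x in lebesgue. Re (f x) = g x"
    by (rule lborel_representative_real[OF m(1)])
  obtain h where h: "h \<in> borel_measurable lborel" "AE x in lebesgue. Im (f x) = h x"
    by (rule lborel_representative_real[OF m(2)])
  have "(\<lambda>x. Complex (g x) (h x)) \<in> borel_measurable lborel"
    using g(1) h(1) by (simp add: Complex_eq)
  moreover have "AE x in lebesgue. f x = Complex (g x) (h x)"
    using g(2) h(2) by eventually_elim (simp add: complex_eq_iff)
  ultimately show ?thesis by (rule that)
qed

text \<open>Integration by parts for indefinite integrals: the product of the two integrals is the
  integral of \<open>f t * g s\<close> over the plane, which is cut along the diagonal, and Fubini's
  theorem is applied to each half in the suitable order. The second claim supplies measurability
  when the identity is carried over to \<open>lebesgue\<close>.\<close>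

lemma integral_mult_split_at_diagonal_lborel:
  fixes f g :: "real \<Rightarrow> complex"
  assumes f: "integrable lborel f" and g: "integrable lborel g"
  shows "(LINT t|lborel. f t * (LINT s:{..t}|lborel. g s)) + (LINT t|lborel. (LINT s:{..t}|lborel. f s) * g t)
    = (LINT t|lborel. f t) * (LINT t|lborel. g t)"
    and "integrable lborel (\<lambda>t. f t * (LINT s:{..t}|lborel. g s))"
proof -
  have [measurable]: "f \<in> borel_measurable lborel" "g \<in> borel_measurable lborel"
    using f g by auto
  have fg: "integrable (lborel \<Otimes>\<^sub>M lborel) (\<lambda>(t,s). f t * g s)"
  proof (rule lborel_pair.Fubini_integrable)
    show "(\<lambda>(t, s). f t * g s) \<in> borel_measurable (lborel \<Otimes>\<^sub>M lborel)"
      by measurable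
    show "integrable lborel (\<lambda>x. LINT y|lborel. norm ((\<lambda>(t, s). f t * g s) (x, y)))"
      using f by (simp add: norm_mult)
    show "AE x in lborel. integrable lborel (\<lambda>y. (\<lambda>(t, s). f t * g s) (x, y))"
      using g by simp
  qed
  have 1: "integrable (lborel \<Otimes>\<^sub>M lborel) (\<lambda>(t,s). of_bool (s \<le> t) * (f t * g s))"
    by (rule Bochner_Integration.integrable_bound[OF fg], measurable) (simp add: case_prod_unfold norm_mult)
  have 2: "integrable (lborel \<Otimes>\<^sub>M lborel) (\<lambda>(t,s). of_bool (t < s) * (f t * g s))"
    by (rule Bochner_Integration.integrable_bound[OF fg], measurable) (simp add: case_prod_unfold norm_mult)
  have i1: "(\<lambda>t. LINT s|lborel. of_bool (s \<le> t) * (f t * g s)) = (\<lambda>t. f t * (LINT s:{..t}|lborel. g s))"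
  proof
    fix t
    have "(LINT s|lborel. of_bool (s \<le> t) * (f t * g s)) = (LINT s|lborel. f t * (indicator {..t} s *\<^sub>R g s))"
      by (rule Bochner_Integration.integral_cong) (auto simp: indicator_def)
    then show "(LINT s|lborel. of_bool (s \<le> t) * (f t * g s)) = f t * (LINT s:{..t}|lborel. g s)"
      by (simp only: set_lebesgue_integral_def integral_mult_right_zero)
  qed
  \<comment> \<open>The strict half-plane \<open>t < s\<close> produces an open ray; closing it
    costs the single point \<open>t = s\<close>.\<close>
  have i2: "(LINT t|lborel. of_bool (t < s) * (f t * g s)) = (LINT s:{..s}|lborel. f s) * g s" for s
  proof -
    have "(LINT t|lborel. of_bool (t < s) * (f t * g s)) = (LINT t|lborel. (indicator {..s} t *\<^sub>R f t) * g s)"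
    proof (rule integral_cong_AE)
      show "AE x in lborel. of_bool (x < s) * (f x * g s) = (indicator {..s} x *\<^sub>R f x) * g s"
        using AE_lborel_singleton[of s] by eventually_elim (auto simp: indicator_def)
    qed measurable
    then show ?thesis
      unfolding set_lebesgue_integral_def by (rule trans) (rule integral_mult_left_zero)
  qed
  show "integrable lborel (\<lambda>t. f t * (LINT s:{..t}|lborel. g s))"
    using lborel_pair.integrable_fst[OF 1] by (simp only: i1)
  have "(LINT t|lborel. f t) * (LINT t|lborel. g t) = (LINT p|(lborel \<Otimes>\<^sub>M lborel). (\<lambda>(t,s). f t * g s) p)"
    using lborel_pair.integral_fst[OF fg] by simp
  also have "\<dots> = (LINT p|(lborel \<Otimes>\<^sub>M lborel). (\<lambda>(t,s). of_bool (s \<le> t) * (f t * g s)) p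
        + (\<lambda>(t,s). of_bool (t < s) * (f t * g s)) p)"
    by (intro Bochner_Integration.integral_cong) auto
  also have "\<dots> = (LINT p|(lborel \<Otimes>\<^sub>M lborel). (\<lambda>(t,s). of_bool (s \<le> t) * (f t * g s)) p)
        + (LINT p|(lborel \<Otimes>\<^sub>M lborel). (\<lambda>(t,s). of_bool (t < s) * (f t * g s)) p)"
    by (rule Bochner_Integration.integral_add[OF 1 2])
  also have "(LINT p|(lborel \<Otimes>\<^sub>M lborel). (\<lambda>(t,s). of_bool (s \<le> t) * (f t * g s)) p)
     = (LINT t|lborel. f t * (LINT s:{..t}|lborel. g s))"
    using lborel_pair.integral_fst[OF 1] by (simp add: i1)
  also have "(LINT p|(lborel \<Otimes>\<^sub>M lborel). (\<lambda>(t,s). of_bool (t < s) * (f t * g s)) p)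
     = (LINT t|lborel. (LINT s:{..t}|lborel. f s) * g t)"
    using lborel_pair.integral_snd[OF 2] by (simp add: i2)
  finally show "(LINT t|lborel. f t * (LINT s:{..t}|lborel. g s)) + (LINT t|lborel. (LINT s:{..t}|lborel. f s) * g t)
    = (LINT t|lborel. f t) * (LINT t|lborel. g t)" by simp
qed

text \<open>Completeness of \<open>lebesgue\<close> makes \<open>g\<close> measurable, so no
  separate measurability assumption is imposed on it.\<close>

lemma integrable_lebesgue_cong_AE:
  fixes f g :: "real \<Rightarrow> 'a::euclidean_space"
  assumes "integrable lebesgue f" "AE x in lebesgue. f x = g x"
  shows "integrable lebesgue g"
  by (rule integrable_cong_AE_imp[OF assms(1) borel_measurable_AE[OF borel_measurable_integrable[OF assms(1)] assms(2)] assms(2)])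

text \<open>Fubini's theorem is available for \<open>lborel\<close>, whereas members of Lebesgue
  spaces are only Lebesgue measurable. Both functions are exchanged for Borel representatives, which
  changes none of the integrals.\<close>

lemma integral_mult_split_at_diagonal:
  fixes f g :: "real \<Rightarrow> complex"
  assumes f: "integrable lebesgue f" and g: "integrable lebesgue g"
  shows "(LINT t|lebesgue. f t * (LINT s:{..t}|lebesgue. g s)) + (LINT t|lebesgue. (LINT s:{..t}|lebesgue. f s) * g t)
    = (LINT t|lebesgue. f t) * (LINT t|lebesgue. g t)"
proof -
  obtain f' where f': "f' \<in> borel_measurable lborel" "AE x in lebesgue. f x = f' x"
    by (rule lborel_representative_complex[OF borel_measurable_integrable[OF f]])
  obtain g' where g': "g' \<in> borel_measurable lborel" "AE x in lebesgue. g x = g' x"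
    by (rule lborel_representative_complex[OF borel_measurable_integrable[OF g]])
  have F': "integrable lebesgue f'" and G': "integrable lebesgue g'"
    by (rule integrable_lebesgue_cong_AE[OF f f'(2)], rule integrable_lebesgue_cong_AE[OF g g'(2)])
  then have F: "integrable lborel f'" and G: "integrable lborel g'"
    using f' g' by (simp_all add: integrable_completion)
  have set: "(LINT s:{..t}|lebesgue. h s) = (LINT s:{..t}|lborel. h' s)"
    if "integrable lebesgue h" "h' \<in> borel_measurable lborel" "AE x in lebesgue. h x = h' x" for t and h h' :: "real \<Rightarrow> complex"
  proof -
    have "(LINT s:{..t}|lebesgue. h s) = (LINT s:{..t}|lebesgue. h' s)"
      unfolding set_lebesgue_integral_def
    proof (rule integral_cong_AE)
      show "(\<lambda>x. indicator {..t} x *\<^sub>R h x) \<in> borel_measurable lebesgue"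
        using that(1) by (intro borel_measurable_scaleR borel_measurable_indicator) auto
      show "(\<lambda>x. indicator {..t} x *\<^sub>R h' x) \<in> borel_measurable lebesgue"
        using that(2) by (intro borel_measurable_scaleR borel_measurable_indicator measurable_completion) auto
      show "AE x in lebesgue. indicator {..t} x *\<^sub>R h x = indicator {..t} x *\<^sub>R h' x"
        using that(3) by eventually_elim simp
    qed
    also have "\<dots> = (LINT s:{..t}|lborel. h' s)"
      unfolding set_lebesgue_integral_def
      by (rule integral_completion) (use that in auto)
    finally show ?thesis .
  qed
  have s: "(LINT s:{..t}|lebesgue. f s) = (LINT s:{..t}|lborel. f' s)"
    "(LINT s:{..t}|lebesgue. g s) = (LINT s:{..t}|lborel. g' s)" for t
    by (rule set[OF f f'], rule set[OF g g'])
  \<comment> \<open>The instance with exchanged roles provides the measurability of the second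
    summand.\<close>
  note I = integral_mult_split_at_diagonal_lborel[OF F G]
    integral_mult_split_at_diagonal_lborel[OF G F]
  have m1: "(\<lambda>t. f' t * (LINT s:{..t}|lborel. g' s)) \<in> borel_measurable lborel"
    by (rule borel_measurable_integrable[OF I(2)])
  have m2: "(\<lambda>t. (LINT s:{..t}|lborel. f' s) * g' t) \<in> borel_measurable lborel"
    using borel_measurable_integrable[OF I(4)] by (simp add: mult.commute)
  have "(LINT t|lebesgue. f t * (LINT s:{..t}|lebesgue. g s)) = (LINT t|lborel. f' t * (LINT s:{..t}|lborel. g' s))"
    unfolding s integral_completion[OF m1, symmetric]
  proof (rule integral_cong_AE)
    show ae: "AE x in lebesgue. f x * (LINT s:{..x}|lborel. g' s) = f' x * (LINT s:{..x}|lborel. g' s)"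
      using f'(2) by eventually_elim simp
    show m: "(\<lambda>x. f' x * (LINT s:{..x}|lborel. g' s)) \<in> borel_measurable lebesgue"
      by (rule measurable_completion[OF m1])
    show "(\<lambda>x. f x * (LINT s:{..x}|lborel. g' s)) \<in> borel_measurable lebesgue"
      by (rule borel_measurable_AE[OF m]) (rule AE_mp[OF ae], simp)
  qed
  moreover have "(LINT t|lebesgue. (LINT s:{..t}|lebesgue. f s) * g t) = (LINT t|lborel. (LINT s:{..t}|lborel. f' s) * g' t)"
    unfolding s integral_completion[OF m2, symmetric]
  proof (rule integral_cong_AE)
    show ae: "AE x in lebesgue. (LINT s:{..x}|lborel. f' s) * g x = (LINT s:{..x}|lborel. f' s) * g' x"
      using g'(2) by eventually_elim simp
    show m: "(\<lambda>x. (LINT s:{..x}|lborel. f' s) * g' x) \<in> borel_measurable lebesgue"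
      by (rule measurable_completion[OF m2])
    show "(\<lambda>x. (LINT s:{..x}|lborel. f' s) * g x) \<in> borel_measurable lebesgue"
      by (rule borel_measurable_AE[OF m]) (rule AE_mp[OF ae], simp)
  qed
  moreover have "(LINT t|lebesgue. f t) = (LINT t|lborel. f' t)" "(LINT t|lebesgue. g t) = (LINT t|lborel. g' t)"
    unfolding integral_completion[OF f'(1), symmetric] integral_completion[OF g'(1), symmetric]
    using integral_cong_AE[OF borel_measurable_integrable[OF f] borel_measurable_integrable[OF F'] f'(2)]
     integral_cong_AE[OF borel_measurable_integrable[OF g] borel_measurable_integrable[OF G'] g'(2)] .
  ultimately show ?thesis using I(1) by simp
qed

section \<open>Calculus of indefinite Lebesgue integrals\<close>

lemma has_ac_derivative_integrable:
  "has_ac_derivative u d \<Longrightarrow> set_integrable lebesgue {x..y} d"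
  by (simp add: has_ac_derivative_def locally_integrable_def)

lemma has_ac_derivative_integral:
  "has_ac_derivative u d \<Longrightarrow> x \<le> y \<Longrightarrow> (LINT t:{x..y}|lebesgue. d t) = u y - u x"
  by (simp add: has_ac_derivative_def)

lemma has_ac_derivativeI:
  assumes "\<And>x y. x \<le> y \<Longrightarrow> set_integrable lebesgue {x..y} d"
    and "\<And>x y. x \<le> y \<Longrightarrow> (LINT t:{x..y}|lebesgue. d t) = u y - u x"
  shows "has_ac_derivative u d"
proof -
  have "set_integrable lebesgue {x..y} d" for x y
    by (cases "x \<le> y") (simp_all add: assms(1))
  then show ?thesis
    by (simp add: has_ac_derivative_def locally_integrable_def assms(2))
qed

text \<open>Turns an equation that holds almost everywhere into a statement with an explicitly given
  derivative.\<close>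

lemma has_ac_derivative_cong_AE:
  assumes u: "has_ac_derivative u d" and ae: "AE x in lebesgue. d x = d' x"
  shows "has_ac_derivative u d'"
proof -
  have ae': "AE t in lebesgue. indicator {x..y} t *\<^sub>R d t = indicator {x..y} t *\<^sub>R d' t" for x y :: real
    using ae by eventually_elim simp
  have i: "set_integrable lebesgue {x..y} d'" for x y
    unfolding set_integrable_def
    by (rule integrable_lebesgue_cong_AE[OF has_ac_derivative_integrable[OF u, unfolded set_integrable_def] ae'])
  have "(LINT t:{x..y}|lebesgue. d' t) = (LINT t:{x..y}|lebesgue. d t)" for x y
    unfolding set_lebesgue_integral_def
    by (rule integral_cong_AE[OF _ _ ae', symmetric])
       (use has_ac_derivative_integrable[OF u] i in \<open>auto simp: set_integrable_def\<close>)
  then show ?thesis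
    using u i by (auto intro!: has_ac_derivativeI simp: has_ac_derivative_integral)
qed

lemma has_ac_derivative_bounded_linear:
  assumes u: "has_ac_derivative u d" and h: "bounded_linear h"
  shows "has_ac_derivative (\<lambda>x. h (u x)) (\<lambda>x. h (d x))"
proof (rule has_ac_derivativeI)
  interpret h: bounded_linear h by fact
  fix x y :: real assume "x \<le> y"
  note i = has_ac_derivative_integrable[OF u, unfolded set_integrable_def, of x y]
  show "set_integrable lebesgue {x..y} (\<lambda>x. h (d x))"
    using integrable_bounded_linear[OF h i] by (simp add: set_integrable_def h.scaleR)
  have "(LINT t:{x..y}|lebesgue. h (d t)) = h (LINT t:{x..y}|lebesgue. d t)"
    using integral_bounded_linear[OF h i] by (simp add: set_lebesgue_integral_def h.scaleR)
  then show "(LINT t:{x..y}|lebesgue. h (d t)) = h (u y) - h (u x)"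
    using has_ac_derivative_integral[OF u \<open>x \<le> y\<close>] by (simp add: h.diff)
qed

lemma has_ac_derivative_add:
  assumes "has_ac_derivative u d" "has_ac_derivative v e"
  shows "has_ac_derivative (\<lambda>x. u x + v x) (\<lambda>x. d x + e x)"
  by (rule has_ac_derivativeI)
     (simp_all add: assms[THEN has_ac_derivative_integrable] assms[THEN has_ac_derivative_integral])

lemma has_ac_derivative_cmult:
  fixes u :: "real \<Rightarrow> complex"
  shows "has_ac_derivative u d \<Longrightarrow> has_ac_derivative (\<lambda>x. c * u x) (\<lambda>x. c * d x)"
  using has_ac_derivative_bounded_linear bounded_linear_mult_right by blast

lemma has_ac_derivative_uminus:
  "has_ac_derivative u d \<Longrightarrow> has_ac_derivative (\<lambda>x. - u x) (\<lambda>x. - d x)"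
  using has_ac_derivative_bounded_linear[OF _ bounded_linear_minus[OF bounded_linear_ident]] by blast

lemma has_ac_derivative_diff:
  "has_ac_derivative u d \<Longrightarrow> has_ac_derivative v e \<Longrightarrow> has_ac_derivative (\<lambda>x. u x - v x) (\<lambda>x. d x - e x)"
  using has_ac_derivative_add[OF _ has_ac_derivative_uminus] by force

lemma has_ac_derivative_continuous:
  assumes u: "has_ac_derivative u d"
  shows "continuous_on A u"
proof -
  have "isCont u x" for x
  proof -
    let ?a = "x - 1" and ?b = "x + 1"
    note i = has_ac_derivative_integrable[OF u]
    have "continuous_on {?a..?b} (\<lambda>t. u ?a + integral {?a..t} d)"
      by (intro continuous_intros indefinite_integral_continuous_1 set_lebesgue_integral_eq_integral(1)[OF i])
    then have "continuous_on {?a..?b} u"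
    proof (rule continuous_on_eq)
      fix t assume "t \<in> {?a..?b}"
      then show "u ?a + integral {?a..t} d = u t"
        using has_ac_derivative_integral[OF u, of ?a t] set_lebesgue_integral_eq_integral(2)[OF i, of ?a t] by simp
    qed
    then show "isCont u x"
      by (rule continuous_on_interior) (simp add: interior_atLeastAtMost_real)
  qed
  then show ?thesis
    by (simp add: continuous_at_imp_continuous_on)
qed

text \<open>No pointwise derivative is used. The derivatives are cut off outside
  \<open>{x..y}\<close>, so that the inner integrals of
  \<open>integral_mult_split_at_diagonal\<close> become \<open>v t - v x\<close> and
  \<open>u t - u x\<close> and the right-hand side becomes \<open>(u y - u x) * (v y - v x)\<close>;
  rearranging gives the product rule in integrated form.\<close>

lemma has_ac_derivative_mult:
  fixes u v :: "real \<Rightarrow> complex"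
  assumes u: "has_ac_derivative u d" and v: "has_ac_derivative v e"
  shows "has_ac_derivative (\<lambda>x. u x * v x) (\<lambda>x. d x * v x + u x * e x)"
proof (rule has_ac_derivativeI)
  fix x y :: real assume xy: "x \<le> y"
  let ?d = "\<lambda>t. indicator {x..y} t *\<^sub>R d t" and ?e = "\<lambda>t. indicator {x..y} t *\<^sub>R e t"
  have D: "integrable lebesgue ?d" and E: "integrable lebesgue ?e"
    using has_ac_derivative_integrable[OF u] has_ac_derivative_integrable[OF v] by (auto simp: set_integrable_def)
  have bd: "bounded (w ` {x..y})" if "has_ac_derivative w w'" for w w' :: "real \<Rightarrow> complex"
    using has_ac_derivative_continuous[OF that] by (intro compact_imp_bounded compact_continuous_image) auto
  have ms: "w \<in> borel_measurable (lebesgue_on {x..y})" if "has_ac_derivative w w'" for w w' :: "real \<Rightarrow> complex"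
    by (rule continuous_imp_measurable_on_sets_lebesgue[OF has_ac_derivative_continuous[OF that]]) simp
  have "set_integrable lebesgue {x..y} (\<lambda>t. v t * d t)"
    by (rule absolutely_integrable_bounded_measurable_product[OF bilinear_times ms[OF v] _ bd[OF v]])
       (use has_ac_derivative_integrable[OF u] in auto)
  then have i1: "set_integrable lebesgue {x..y} (\<lambda>t. d t * v t)" by (simp add: mult.commute)
  have i2: "set_integrable lebesgue {x..y} (\<lambda>t. u t * e t)"
    by (rule absolutely_integrable_bounded_measurable_product[OF bilinear_times ms[OF u] _ bd[OF u]])
       (use has_ac_derivative_integrable[OF v] in auto)
  show "set_integrable lebesgue {x..y} (\<lambda>x. d x * v x + u x * e x)"
    using i1 i2 by simp
  have cut: "(LINT s:{..t}|lebesgue. indicator {x..y} s *\<^sub>R w' s) = w t - w x"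
    if "has_ac_derivative w w'" "t \<in> {x..y}" for t and w w' :: "real \<Rightarrow> complex"
  proof -
    have "(LINT s:{..t}|lebesgue. indicator {x..y} s *\<^sub>R w' s) = (LINT s:{x..t}|lebesgue. w' s)"
      unfolding set_lebesgue_integral_def
      by (rule Bochner_Integration.integral_cong) (use that in \<open>auto simp: indicator_def\<close>)
    then show ?thesis
      using has_ac_derivative_integral[OF that(1), of x t] that(2) by simp
  qed
  have 1: "(LINT t|lebesgue. ?d t * (LINT s:{..t}|lebesgue. ?e s))
       = (LINT t:{x..y}|lebesgue. d t * v t - d t * v x)"
    unfolding set_lebesgue_integral_def[of _ "{x..y}"]
    by (rule Bochner_Integration.integral_cong) (auto simp: cut[OF v] algebra_simps split: split_indicator)
  have 2: "(LINT t|lebesgue. (LINT s:{..t}|lebesgue. ?d s) * ?e t)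
       = (LINT t:{x..y}|lebesgue. u t * e t - u x * e t)"
    unfolding set_lebesgue_integral_def[of _ "{x..y}"]
    by (rule Bochner_Integration.integral_cong) (auto simp: cut[OF u] algebra_simps split: split_indicator)
  have 3: "(LINT t:{x..y}|lebesgue. d t * v t - d t * v x) = (LINT t:{x..y}|lebesgue. d t * v t) - (u y - u x) * v x"
    using i1 has_ac_derivative_integrable[OF u, of x y] has_ac_derivative_integral[OF u xy] by simp
  have 4: "(LINT t:{x..y}|lebesgue. u t * e t - u x * e t) = (LINT t:{x..y}|lebesgue. u t * e t) - u x * (v y - v x)"
    using i2 has_ac_derivative_integrable[OF v, of x y] has_ac_derivative_integral[OF v xy] by simp
  have 5: "(LINT t|lebesgue. ?d t) = u y - u x" "(LINT t|lebesgue. ?e t) = v y - v x"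
    using has_ac_derivative_integral[OF u xy] has_ac_derivative_integral[OF v xy]
    by (simp_all add: set_lebesgue_integral_def)
  have "(LINT t:{x..y}|lebesgue. d t * v t) - (u y - u x) * v x + ((LINT t:{x..y}|lebesgue. u t * e t) - u x * (v y - v x))
     = (u y - u x) * (v y - v x)"
    using integral_mult_split_at_diagonal[OF D E] unfolding 1 2 3 4 5 .
  then show "(LINT t:{x..y}|lebesgue. d t * v t + u t * e t) = u y * v y - u x * v x"
    using i1 i2 by (simp add: algebra_simps)
qed

lemma has_ac_derivative_C1:
  fixes u :: "real \<Rightarrow> 'a::euclidean_space"
  assumes "\<And>x. (u has_vector_derivative d x) (at x)" and "continuous_on UNIV d"
  shows "has_ac_derivative u d"
proof (rule has_ac_derivativeI)
  fix x y :: real assume xy: "x \<le> y"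
  show i: "set_integrable lebesgue {x..y} d"
    using assms(2) continuous_on_subset by (intro absolutely_integrable_continuous_real) blast
  have "(d has_integral (u y - u x)) {x..y}"
    by (rule fundamental_theorem_of_calculus[OF xy]) (simp add: assms(1) has_vector_derivative_at_within)
  then show "(LINT t:{x..y}|lebesgue. d t) = u y - u x"
    using set_lebesgue_integral_eq_integral(2)[OF i] by (simp add: integral_unique)
qed

lemma has_ac_derivative_shift:
  assumes u: "has_ac_derivative u d"
  shows "has_ac_derivative (\<lambda>x. u (x + c)) (\<lambda>x. d (x + c))"
proof (rule has_ac_derivativeI)
  fix x y :: real assume xy: "x \<le> y"
  have ind: "indicator {x + c..y + c} (c + 1 * t) *\<^sub>R d (c + 1 * t) = indicator {x..y} t *\<^sub>R d (t + c)" for t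
    by (auto simp: indicator_def add.commute)
  note i = has_ac_derivative_integrable[OF u, of "x + c" "y + c", unfolded set_integrable_def]
  show "set_integrable lebesgue {x..y} (\<lambda>x. d (x + c))"
    unfolding set_integrable_def using lebesgue_integrable_real_affine[OF i, of 1 c] unfolding ind by simp
  show "(LINT t:{x..y}|lebesgue. d (t + c)) = u (y + c) - u (x + c)"
    using lebesgue_integral_real_affine[of 1 "\<lambda>t. indicator {x + c..y + c} t *\<^sub>R d t" c]
      has_ac_derivative_integral[OF u, of "x + c" "y + c"] xy
    unfolding ind by (simp add: set_lebesgue_integral_def)
qed

lemma set_integral_Ioc_eq_Icc:
  fixes h :: "real \<Rightarrow> 'a::euclidean_space"
  assumes i: "set_integrable lebesgue {x..y} h"
  shows "(LINT t:{x<..y}|lebesgue. h t) = (LINT t:{x..y}|lebesgue. h t)"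
proof (rule set_integral_cong_set)
  have i': "set_integrable lebesgue {x<..y} h"
    by (rule set_integrable_subset[OF i]) auto
  show "set_borel_measurable lebesgue {x<..y} h" "set_borel_measurable lebesgue {x..y} h"
    unfolding set_borel_measurable_def
    by (rule borel_measurable_integrable[OF i'[unfolded set_integrable_def]]
        borel_measurable_integrable[OF i[unfolded set_integrable_def]])+
  have "AE t in lebesgue. t \<noteq> x"
    by (rule AE_completion[OF AE_lborel_singleton])
  then show "AE t in lebesgue. (t \<in> {x..y}) = (t \<in> {x<..y})"
    by eventually_elim auto
qed

text \<open>Together with the upper tail this differentiates the coefficients in variation of
  constants. The rays \<open>{..x}\<close> and \<open>{x<..}\<close> are chosen
  complementary.\<close>

lemma has_ac_derivative_lower_tail:
  fixes h :: "real \<Rightarrow> 'a::euclidean_space"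
  assumes h: "\<And>x. set_integrable lebesgue {..x} h"
  shows "has_ac_derivative (\<lambda>x. LINT t:{..x}|lebesgue. h t) h"
proof (rule has_ac_derivativeI)
  fix x y :: real assume xy: "x \<le> y"
  show i: "set_integrable lebesgue {x..y} h"
    by (rule set_integrable_subset[OF h[of y]]) auto
  have "(LINT t:{..y}|lebesgue. h t) = (LINT t:({..x} \<union> {x<..y})|lebesgue. h t)"
    using xy by (simp add: ivl_disj_un_one)
  also have "\<dots> = (LINT t:{..x}|lebesgue. h t) + (LINT t:{x<..y}|lebesgue. h t)"
    by (rule set_integral_Un) (use h in \<open>auto intro: set_integrable_subset[OF i]\<close>)
  also have "(LINT t:{x<..y}|lebesgue. h t) = (LINT t:{x..y}|lebesgue. h t)"
    by (rule set_integral_Ioc_eq_Icc[OF i])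
  finally show "(LINT t:{x..y}|lebesgue. h t) = (LINT t:{..y}|lebesgue. h t) - (LINT t:{..x}|lebesgue. h t)"
    by simp
qed

lemma has_ac_derivative_upper_tail:
  fixes h :: "real \<Rightarrow> 'a::euclidean_space"
  assumes h: "\<And>x. set_integrable lebesgue {x<..} h"
  shows "has_ac_derivative (\<lambda>x. LINT t:{x<..}|lebesgue. h t) (\<lambda>t. - h t)"
proof (rule has_ac_derivativeI)
  fix x y :: real assume xy: "x \<le> y"
  \<comment> \<open>The ray \<open>{x<..}\<close> misses the endpoint \<open>x\<close>, so the
    closed interval is placed inside the ray that starts at \<open>x - 1\<close>.\<close>
  have i: "set_integrable lebesgue {x..y} h"
    by (rule set_integrable_subset[OF h[of "x - 1"]]) auto
  then show "set_integrable lebesgue {x..y} (\<lambda>t. - h t)"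
    by (simp add: set_integrable_def)
  have "(LINT t:{x<..}|lebesgue. h t) = (LINT t:({x<..y} \<union> {y<..})|lebesgue. h t)"
    using xy by (simp add: ivl_disj_un_one)
  also have "\<dots> = (LINT t:{x<..y}|lebesgue. h t) + (LINT t:{y<..}|lebesgue. h t)"
    by (rule set_integral_Un) (use h in \<open>auto intro: set_integrable_subset[OF i]\<close>)
  also have "(LINT t:{x<..y}|lebesgue. h t) = (LINT t:{x..y}|lebesgue. h t)"
    by (rule set_integral_Ioc_eq_Icc[OF i])
  finally show "(LINT t:{x..y}|lebesgue. - h t) = (LINT t:{y<..}|lebesgue. h t) - (LINT t:{x<..}|lebesgue. h t)"
    using set_integral_uminus[OF i] by simp
qed

section \<open>Hoelder's and Young's inequalities\<close>

text \<open>The half-line integral \<open>1 / c\<close> is used twice, once translated and once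
  reflected; the two copies overlap only at \<open>x = t\<close>, a null set.\<close>

lemma has_bochner_integral_exp_abs:
  assumes c: "c > 0"
  shows "has_bochner_integral lebesgue (\<lambda>x. exp (- c * \<bar>t - x\<bar>)) (2 / c :: real)"
proof -
  let ?g = "\<lambda>x. indicator {0..} x *\<^sub>R exp (- c * x) :: real"
  have set: "set_integrable lebesgue {0..} (\<lambda>x. exp (- c * x))"
    using integrable_on_exp_minus_to_infinity[OF c] by (intro nonnegative_absolutely_integrable_1) auto
  then have "integrable lebesgue ?g" by (simp add: set_integrable_def)
  moreover have "(LINT x|lebesgue. ?g x) = 1 / c"
    using set_lebesgue_integral_eq_integral(2)[OF set] has_integral_exp_minus_to_infinity[OF c, of 0]
    by (simp add: set_lebesgue_integral_def integral_unique)
  ultimately have g: "has_bochner_integral lebesgue ?g (1 / c)" by (simp add: has_bochner_integral_iff)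
  have "has_bochner_integral lebesgue (\<lambda>x. ?g (- t + 1 * x)) (1 / c)"
    using has_bochner_integral_lebesgue_real_affine_iff[of 1 ?g "1/c" "-t"] g by simp
  moreover have "has_bochner_integral lebesgue (\<lambda>x. ?g (t + (-1) * x)) (1 / c)"
    using has_bochner_integral_lebesgue_real_affine_iff[of "-1" ?g "1/c" t] g by simp
  ultimately have 1: "has_bochner_integral lebesgue (\<lambda>x. ?g (- t + 1 * x) + ?g (t + (-1) * x)) (1 / c + 1 / c)"
    by (rule has_bochner_integral_add)
  have ae: "AE x in lebesgue. ?g (- t + 1 * x) + ?g (t + (-1) * x) = exp (- c * \<bar>t - x\<bar>)"
    using AE_completion[OF AE_lborel_singleton[of t]] by eventually_elim (auto simp: indicator_def)
  have "integrable lebesgue (\<lambda>x. exp (- c * \<bar>t - x\<bar>))"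
    by (rule integrable_lebesgue_cong_AE[OF _ ae]) (use 1 in \<open>simp only: has_bochner_integral_iff\<close>)
  moreover have "(LINT x|lebesgue. exp (- c * \<bar>t - x\<bar>)) = (LINT x|lebesgue. ?g (- t + 1 * x) + ?g (t + (-1) * x))"
    by (rule integral_cong_AE[OF _ _ ae, symmetric])
       (use 1 calculation in \<open>auto simp only: has_bochner_integral_iff intro: borel_measurable_integrable\<close>)
  ultimately show ?thesis
    using 1 by (simp add: has_bochner_integral_iff)
qed

text \<open>By Fubini's theorem the kernel may be integrated in \<open>x\<close> first, which gives
  \<open>2 / c\<close> for every \<open>t\<close>. The exchange is made for a Borel representative
  of \<open>h\<close> and then carried back to \<open>lebesgue\<close>.\<close>

lemma
  assumes c: "c > 0" and h: "integrable lebesgue h"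
  shows integrable_exp_abs_convolution: "integrable lebesgue (\<lambda>x. LINT t|lebesgue. exp (- c * \<bar>t - x\<bar>) * h t)"
    and integral_exp_abs_convolution:
      "(LINT x|lebesgue. LINT t|lebesgue. exp (- c * \<bar>t - x\<bar>) * h t) = 2 / c * (LINT t|lebesgue. h t :: real)"
proof -
  obtain g where g: "g \<in> borel_measurable lborel" "AE x in lebesgue. h x = g x"
    by (rule lborel_representative_real[OF borel_measurable_integrable[OF h]])
  note [measurable] = g(1)
  have G': "integrable lebesgue g"
    by (rule integrable_lebesgue_cong_AE[OF h g(2)])
  then have G: "integrable lborel g" using g(1) by (simp add: integrable_completion)
  have e: "integrable lborel (\<lambda>x. exp (- c * \<bar>t - x\<bar>))" "(LINT x|lborel. exp (- c * \<bar>t - x\<bar>)) = 2 / c" for t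
    using has_bochner_integral_exp_abs[OF c, of t]
    by (auto simp: has_bochner_integral_iff integrable_completion integral_completion)
  let ?F = "\<lambda>(t,x). exp (- c * \<bar>t - x\<bar>) * g t"
  have F: "integrable (lborel \<Otimes>\<^sub>M lborel) ?F"
  proof (rule lborel_pair.Fubini_integrable)
    show "?F \<in> borel_measurable (lborel \<Otimes>\<^sub>M lborel)" by measurable
    show "integrable lborel (\<lambda>x. LINT y|lborel. norm (?F (x, y)))"
      using G by (simp add: abs_mult e[simplified])
    show "AE x in lborel. integrable lborel (\<lambda>y. ?F (x, y))"
      using e by simp
  qed
  have eq: "(LINT t|lebesgue. exp (- c * \<bar>t - x\<bar>) * h t) = (LINT t|lborel. exp (- c * \<bar>t - x\<bar>) * g t)" for x
  proof -
    have "(LINT t|lebesgue. exp (- c * \<bar>t - x\<bar>) * h t) = (LINT t|lebesgue. exp (- c * \<bar>t - x\<bar>) * g t)"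
    proof (rule integral_cong_AE)
      show "(\<lambda>t. exp (- c * \<bar>t - x\<bar>) * h t) \<in> borel_measurable lebesgue"
        by (intro borel_measurable_times borel_measurable_integrable[OF h] measurable_completion) measurable
      show "(\<lambda>t. exp (- c * \<bar>t - x\<bar>) * g t) \<in> borel_measurable lebesgue"
        by (rule measurable_completion) measurable
      show "AE t in lebesgue. exp (- c * \<bar>t - x\<bar>) * h t = exp (- c * \<bar>t - x\<bar>) * g t"
        using g(2) by eventually_elim simp
    qed
    also have "\<dots> = (LINT t|lborel. exp (- c * \<bar>t - x\<bar>) * g t)"
      by (rule integral_completion) measurable
    finally show ?thesis .
  qed
  note I = lborel_pair.integrable_snd[OF F]
  show "integrable lebesgue (\<lambda>x. LINT t|lebesgue. exp (- c * \<bar>t - x\<bar>) * h t)"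
    unfolding eq using I borel_measurable_integrable[OF I] by (simp add: integrable_completion)
  have "(LINT x|lebesgue. LINT t|lborel. exp (- c * \<bar>t - x\<bar>) * g t) = (LINT x|lborel. LINT t|lborel. exp (- c * \<bar>t - x\<bar>) * g t)"
    by (rule integral_completion[OF borel_measurable_integrable[OF I]])
  also have "\<dots> = (LINT t|lborel. LINT x|lborel. exp (- c * \<bar>t - x\<bar>) * g t)"
    by (rule lborel_pair.Fubini_integral[OF F])
  also have "\<dots> = 2 / c * (LINT t|lborel. g t)"
    using e(2) by simp
  also have "(LINT t|lborel. g t) = (LINT t|lebesgue. g t)"
    by (rule integral_completion[symmetric]) (rule g)
  also have "\<dots> = (LINT t|lebesgue. h t)"
    by (rule integral_cong_AE[OF borel_measurable_integrable[OF h] borel_measurable_integrable[OF G'] g(2), symmetric])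
  finally show "(LINT x|lebesgue. LINT t|lebesgue. exp (- c * \<bar>t - x\<bar>) * h t) = 2 / c * (LINT t|lebesgue. h t)"
    unfolding eq .
qed

text \<open>Jensen's inequality for \<open>exp\<close> at the logarithms of the three
  numbers.\<close>

lemma weighted_am_gm3:
  fixes x y z :: real
  assumes "x \<ge> 0" "y \<ge> 0" "z \<ge> 0" "p \<ge> 0" "q \<ge> 0" "r \<ge> 0" "p + q + r = 1"
  shows "x powr p * y powr q * z powr r \<le> p * x + q * y + r * z"
proof (cases "x = 0 \<or> y = 0 \<or> z = 0")
  case True
  then show ?thesis using assms by auto
next
  case False
  then have pos: "x > 0" "y > 0" "z > 0" using assms by auto
  have "exp (\<Sum>i\<in>{0,1,2::nat}. [p,q,r] ! i *\<^sub>R [ln x, ln y, ln z] ! i)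
     \<le> (\<Sum>i\<in>{0,1,2::nat}. [p,q,r] ! i * exp ([ln x, ln y, ln z] ! i))"
    by (rule convex_on_sum[OF _ _ exp_convex]) (use assms in auto)
  then show ?thesis
    using pos by (simp add: powr_def exp_add[symmetric] add.assoc)
qed

text \<open>The degenerate cases are covered thanks to \<open>0 powr 0 = 0\<close>.\<close>

lemma
  fixes f g h :: "'a \<Rightarrow> real"
  assumes int: "integrable M f" "integrable M g" "integrable M h"
    and nn: "\<And>x. f x \<ge> 0" "\<And>x. g x \<ge> 0" "\<And>x. h x \<ge> 0"
    and pqr: "p \<ge> 0" "q \<ge> 0" "r \<ge> 0" "p + q + r = 1"
  shows Holder3_integrable: "integrable M (\<lambda>x. f x powr p * g x powr q * h x powr r)"
    and Holder3_integral: "(LINT x|M. f x powr p * g x powr q * h x powr r)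
      \<le> (LINT x|M. f x) powr p * (LINT x|M. g x) powr q * (LINT x|M. h x) powr r"
proof -
  let ?P = "\<lambda>x. f x powr p * g x powr q * h x powr r"
  let ?A = "LINT x|M. f x" and ?B = "LINT x|M. g x" and ?C = "LINT x|M. h x"
  have m [measurable]: "f \<in> borel_measurable M" "g \<in> borel_measurable M" "h \<in> borel_measurable M"
    using int by auto
  have pm: "?P \<in> borel_measurable M" by measurable
  show I: "integrable M ?P"
  proof (rule Bochner_Integration.integrable_bound)
    show "integrable M (\<lambda>x. p * f x + q * g x + r * h x)" using int by simp
    show "AE x in M. norm (?P x) \<le> norm (p * f x + q * g x + r * h x)"
      using weighted_am_gm3[OF nn pqr] by (intro AE_I2) (smt (verit) mult_nonneg_nonneg powr_ge_zero real_norm_def)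
  qed (rule pm)
  have zero: "integral\<^sup>L M ?P = 0" if "AE x in M. f x = 0 \<or> g x = 0 \<or> h x = 0"
  proof -
    have "integral\<^sup>L M ?P = (LINT x|M. 0)"
    proof (rule integral_cong_AE[OF pm])
      show "AE x in M. ?P x = 0" using that by eventually_elim auto
    qed simp
    then show ?thesis by simp
  qed
  have pos: "?A \<ge> 0" "?B \<ge> 0" "?C \<ge> 0" using nn by simp_all
  show "integral\<^sup>L M ?P \<le> ?A powr p * ?B powr q * ?C powr r"
  proof (cases "?A = 0 \<or> ?B = 0 \<or> ?C = 0")
    case True
    then have "(AE x in M. f x = 0) \<or> (AE x in M. g x = 0) \<or> (AE x in M. h x = 0)"
      using integral_nonneg_eq_0_iff_AE[OF int(1)] integral_nonneg_eq_0_iff_AE[OF int(2)]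
        integral_nonneg_eq_0_iff_AE[OF int(3)] nn by auto
    then have "AE x in M. f x = 0 \<or> g x = 0 \<or> h x = 0"
      by (auto elim: eventually_mono)
    then show ?thesis using zero by simp
  next
    case False
    with pos have pos: "?A > 0" "?B > 0" "?C > 0" by linarith+
    \<comment> \<open>After division by their integrals the three functions have integral 1, so
      integrating the pointwise inequality yields \<open>p + q + r = 1\<close> times the normalising
      factor.\<close>
    let ?K = "?A powr p * ?B powr q * ?C powr r"
    have K: "?K > 0" using pos by simp
    have "integral\<^sup>L M ?P \<le> (LINT x|M. ?K * (p * (f x / ?A) + q * (g x / ?B) + r * (h x / ?C)))"
    proof (rule integral_mono[OF I])
      fix x
      have "(f x / ?A) powr p * (g x / ?B) powr q * (h x / ?C) powr r
          \<le> p * (f x / ?A) + q * (g x / ?B) + r * (h x / ?C)"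
        by (rule weighted_am_gm3) (use nn pos pqr in auto)
      then have "?P x / ?K \<le> p * (f x / ?A) + q * (g x / ?B) + r * (h x / ?C)"
        using nn pos by (simp add: powr_divide)
      then show "?P x \<le> ?K * (p * (f x / ?A) + q * (g x / ?B) + r * (h x / ?C))"
        using K by (simp add: pos_divide_le_eq mult.commute)
    qed (use int in simp)
    also have "\<dots> = ?K * (p * (?A / ?A) + q * (?B / ?B) + r * (?C / ?C))"
      using int by simp
    also have "\<dots> = ?K" using pos pqr by simp
    finally show ?thesis .
  qed
qed

text \<open>The fourth identity is the condition on the exponents in Hoelder's inequality for three
  factors; the fifth collects the powers of the \<open>L^r\<close> integral of \<open>h\<close>
  after raising to the power \<open>r'\<close> and integrating.\<close>

lemma conjugate_exponent:
  fixes r r' :: real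
  assumes "1 < r" "r \<le> 2" "r' = 1 / (1 - 1 / r)"
  shows "r' \<ge> 2" "1 / r' = 1 - 1 / r" "r / r' = r - 1" "1 / r' + 1 / r' + (2 - r) / r = 1"
    "1 + (2 - r) / r * r' = r' / r"
proof -
  have r': "r' = r / (r - 1)" using assms by (simp add: field_simps)
  show "r' \<ge> 2" "1 / r' = 1 - 1 / r" "r / r' = r - 1"
    using assms(1,2) unfolding r' by (auto simp: field_simps)
  then show "1 / r' + 1 / r' + (2 - r) / r = 1"
    using assms(1) by (simp add: diff_divide_distrib)
  show "1 + (2 - r) / r * r' = r' / r"
    using assms(1) unfolding r' by (simp add: field_simps)
qed

section \<open>Young's inequality for the exponential kernel\<close>

context
  fixes \<kappa> r r' :: real and h :: "real \<Rightarrow> real"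
  assumes k: "\<kappa> > 0" and r: "1 < r" "r \<le> 2" "r' = 1 / (1 - 1 / r)"
    and nn: "\<And>t. h t \<ge> 0"
    and int: "integrable lebesgue (\<lambda>t. h t powr r)"
begin

text \<open>
  The kernel \<open>g = exp (- \<kappa> \<bar>\<cdot>\<bar>)\<close> is taken in \<open>L\<^sup>s\<close> with \<open>s = r' / 2\<close>, and
  \<open>g h = (g\<^sup>s h\<^sup>r)\<^bsup>1/r'\<^esup> (g\<^sup>s)\<^bsup>1/r'\<^esup> (h\<^sup>r)\<^bsup>(2-r)/r\<^esup>\<close>.
\<close>

private lemma split:
  "exp (- \<kappa> * \<bar>t - x\<bar>) * h t =
    (exp (- (\<kappa> * r' / 2) * \<bar>t - x\<bar>) * h t powr r) powr (1 / r')
    * exp (- (\<kappa> * r' / 2) * \<bar>t - x\<bar>) powr (1 / r') * (h t powr r) powr ((2 - r) / r)"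
proof (cases "h t = 0")
  case False
  then have pos: "h t > 0" using nn[of t] by linarith
  have rp: "r' \<noteq> 0" "r \<noteq> 0" using conjugate_exponent(1)[OF r] r by auto
  have e: "exp (- (\<kappa> * r' / 2) * \<bar>t - x\<bar>) powr (1 / r') = exp (- (\<kappa> / 2) * \<bar>t - x\<bar>)"
    using rp by (simp add: powr_def)
  have "(exp (- (\<kappa> * r' / 2) * \<bar>t - x\<bar>) * h t powr r) powr (1 / r')
      = exp (- (\<kappa> / 2) * \<bar>t - x\<bar>) * h t powr (r - 1)"
    unfolding powr_mult[of "exp _" "h t powr r", simplified] e using conjugate_exponent(3)[OF r] by (simp add: powr_mult powr_powr e)
  moreover have "(h t powr r) powr ((2 - r) / r) = h t powr (2 - r)"
    using rp by (simp add: powr_powr)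
  moreover have "h t powr (r - 1) * h t powr (2 - r) = h t"
    using pos by (simp add: powr_add[symmetric])
  moreover have "exp (- (\<kappa> / 2) * \<bar>t - x\<bar>) * exp (- (\<kappa> / 2) * \<bar>t - x\<bar>) = exp (- \<kappa> * \<bar>t - x\<bar>)"
    by (simp add: exp_add[symmetric])
  ultimately show ?thesis unfolding e by (simp add: mult_ac)
qed simp

private lemma weight_pos: "\<kappa> * r' / 2 > 0"
  using k conjugate_exponent(1)[OF r] by simp

private lemma integrable_weighted:
  "integrable lebesgue (\<lambda>t. exp (- (\<kappa> * r' / 2) * \<bar>t - x\<bar>) * h t powr r)"
proof (rule Bochner_Integration.integrable_bound[OF int])
  show "(\<lambda>t. exp (- (\<kappa> * r' / 2) * \<bar>t - x\<bar>) * h t powr r) \<in> borel_measurable lebesgue"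
    by (intro borel_measurable_times borel_measurable_integrable[OF int] measurable_completion) measurable
  have "exp (- (\<kappa> * r' / 2) * \<bar>t - x\<bar>) * h t powr r \<le> 1 * h t powr r" for t
    using weight_pos by (intro mult_right_mono) auto
  then show "AE t in lebesgue. norm (exp (- (\<kappa> * r' / 2) * \<bar>t - x\<bar>) * h t powr r) \<le> norm (h t powr r)"
    by (intro AE_I2) (simp add: abs_mult)
qed

text \<open>The rate of \<open>g^s\<close> is \<open>\<kappa> * r' / 2\<close>, and 2 divided by
  this rate is the base of the power in the operator bound.\<close>

private lemma kernel:
  "has_bochner_integral lebesgue (\<lambda>t. exp (- (\<kappa> * r' / 2) * \<bar>t - x\<bar>)) (4 / (r' * \<kappa>))"
  using has_bochner_integral_exp_abs[OF weight_pos, of x] by (simp add: abs_minus_commute mult_ac)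

lemma Young_exp_integrable: "integrable lebesgue (\<lambda>t. exp (- \<kappa> * \<bar>t - x\<bar>) * h t)"
  unfolding split
  by (rule Holder3_integrable[OF integrable_weighted _ int])
     (use kernel[of x] r conjugate_exponent[OF r] nn in \<open>auto simp: has_bochner_integral_iff\<close>)

text \<open>Hoelder's inequality for the three factors of \<open>split\<close>, raised to the power
  \<open>r'\<close>. The first factor then occurs linearly and is the only one that depends on
  \<open>x\<close>, which prepares the integration in \<open>x\<close>.\<close>

private lemma pointwise:
  "(LINT t|lebesgue. exp (- \<kappa> * \<bar>t - x\<bar>) * h t) powr r' \<le>
    (LINT t|lebesgue. exp (- (\<kappa> * r' / 2) * \<bar>t - x\<bar>) * h t powr r) *
    ((4 / (r' * \<kappa>)) * (LINT t|lebesgue. h t powr r) powr ((2 - r) / r * r'))"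
proof -
  let ?A = "LINT t|lebesgue. exp (- (\<kappa> * r' / 2) * \<bar>t - x\<bar>) * h t powr r"
  let ?N = "LINT t|lebesgue. h t powr r" and ?B = "4 / (r' * \<kappa>)"
  have rp: "r' > 0" using conjugate_exponent(1)[OF r] by simp
  have pos: "?A \<ge> 0" "?N \<ge> 0" "?B \<ge> 0" using nn rp k by (simp_all add: integral_nonneg_AE)
  have "(LINT t|lebesgue. exp (- \<kappa> * \<bar>t - x\<bar>) * h t) \<le> ?A powr (1/r') * ?B powr (1/r') * ?N powr ((2 - r) / r)"
    unfolding split
    using Holder3_integral[OF integrable_weighted[of x] _ int, of "\<lambda>t. exp (- (\<kappa> * r' / 2) * \<bar>t - x\<bar>)" "1/r'" "1/r'" "(2 - r)/r"]
      kernel[of x] r conjugate_exponent[OF r] nn by (simp add: has_bochner_integral_iff)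
  then have "(LINT t|lebesgue. exp (- \<kappa> * \<bar>t - x\<bar>) * h t) powr r'
     \<le> (?A powr (1/r') * ?B powr (1/r') * ?N powr ((2 - r) / r)) powr r'"
    by (rule powr_mono2[rotated 2]) (use rp nn in \<open>simp_all add: integral_nonneg_AE\<close>)
  also have "\<dots> = ?A * (?B * ?N powr ((2 - r) / r * r'))"
    using pos rp by (simp add: powr_mult powr_powr mult.assoc)
  finally show ?thesis .
qed

text \<open>The pointwise bound is integrated in \<open>x\<close> by means of the convolution
  identity. Stating it for any \<open>w\<close> dominated by \<open>K\<close> times the convolution
  lets it apply directly to the norm of the Green operator.\<close>

lemma
  fixes w :: "real \<Rightarrow> real"
  assumes w: "w \<in> borel_measurable lebesgue" and K: "K \<ge> 0"
    and bound: "\<And>x. \<bar>w x\<bar> \<le> K * (LINT t|lebesgue. exp (- \<kappa> * \<bar>t - x\<bar>) * h t)"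
  shows Young_exp_Lp: "integrable lebesgue (\<lambda>x. \<bar>w x\<bar> powr r')"
    and Young_exp_norm: "(LINT x|lebesgue. \<bar>w x\<bar> powr r') powr (1 / r')
      \<le> K * (4 / (r' * \<kappa>)) powr (2 / r') * (LINT t|lebesgue. h t powr r) powr (1 / r)"
proof -
  let ?A = "\<lambda>x. LINT t|lebesgue. exp (- (\<kappa> * r' / 2) * \<bar>t - x\<bar>) * h t powr r"
  let ?N = "LINT t|lebesgue. h t powr r" and ?B = "4 / (r' * \<kappa>)"
  define D where "D = K powr r' * (?B * ?N powr ((2 - r) / r * r'))"
  have rp: "r' > 0" using conjugate_exponent(1)[OF r] by simp
  have N: "?N \<ge> 0" by simp
  have B: "?B > 0" using rp k by simp
  have D: "D \<ge> 0" unfolding D_def using B by (intro mult_nonneg_nonneg) auto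
  have b: "\<bar>w x\<bar> powr r' \<le> D * ?A x" for x
  proof -
    have "\<bar>w x\<bar> powr r' \<le> (K * (LINT t|lebesgue. exp (- \<kappa> * \<bar>t - x\<bar>) * h t)) powr r'"
      by (rule powr_mono2) (use rp bound in auto)
    also have "\<dots> = K powr r' * (LINT t|lebesgue. exp (- \<kappa> * \<bar>t - x\<bar>) * h t) powr r'"
      using K nn by (simp add: powr_mult integral_nonneg_AE)
    also have "\<dots> \<le> K powr r' * (?A x * (?B * ?N powr ((2 - r) / r * r')))"
      by (intro mult_left_mono pointwise) auto
    finally show ?thesis by (simp add: D_def mult_ac)
  qed
  have A: "?A x \<ge> 0" for x by (simp add: integral_nonneg_AE)
  have IA: "integrable lebesgue (\<lambda>x. D * ?A x)"
    using integrable_exp_abs_convolution[OF weight_pos int] by simp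
  show I: "integrable lebesgue (\<lambda>x. \<bar>w x\<bar> powr r')"
  proof (rule Bochner_Integration.integrable_bound[OF IA])
    show "(\<lambda>x. \<bar>w x\<bar> powr r') \<in> borel_measurable lebesgue"
      using w by measurable
    show "AE x in lebesgue. norm (\<bar>w x\<bar> powr r') \<le> norm (D * ?A x)"
      using b A D by (intro AE_I2) (simp add: abs_mult)
  qed
  have "(LINT x|lebesgue. \<bar>w x\<bar> powr r') \<le> (LINT x|lebesgue. D * ?A x)"
    by (rule integral_mono[OF I IA b])
  also have "\<dots> = D * (?B * ?N)"
    using integral_exp_abs_convolution[OF weight_pos int] by (simp add: mult_ac)
  \<comment> \<open>One factor \<open>?B\<close> stems from Hoelder's inequality in
    \<open>t\<close>, the other from integrating the kernel in \<open>x\<close>; the resulting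
    square becomes the exponent \<open>2 / r'\<close>.\<close>
  also have "\<dots> = K powr r' * ?B powr 2 * (?N powr 1 * ?N powr ((2 - r) / r * r'))"
    using B N by (simp add: D_def power2_eq_square mult_ac)
  also have "\<dots> = K powr r' * ?B powr 2 * ?N powr (r' / r)"
    unfolding powr_add[symmetric] conjugate_exponent(5)[OF r] ..
  finally have "(LINT x|lebesgue. \<bar>w x\<bar> powr r') powr (1 / r') \<le> (K powr r' * ?B powr 2 * ?N powr (r' / r)) powr (1 / r')"
    by (intro powr_mono2) (use rp in \<open>auto simp: integral_nonneg_AE\<close>)
  also have "\<dots> = K * ?B powr (2 / r') * ?N powr (1 / r)"
    using rp K by (simp add: powr_mult powr_powr)
  finally show "(LINT x|lebesgue. \<bar>w x\<bar> powr r') powr (1 / r') \<le> K * ?B powr (2 / r') * ?N powr (1 / r)" .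
qed

end

section \<open>Vector space operations on Lebesgue spaces\<close>

lemma Lp_space_add:
  assumes p: "p \<ge> 0" and f: "f \<in> Lp_space p" and g: "g \<in> Lp_space p"
  shows "(\<lambda>x. f x + g x) \<in> Lp_space p"
proof -
  have m: "(\<lambda>x. f x + g x) \<in> borel_measurable lebesgue"
    by (rule borel_measurable_add) (use f g in \<open>simp_all add: Lp_space_def\<close>)
  have b: "norm (f x + g x) powr p \<le> 2 powr p * norm (f x) powr p + 2 powr p * norm (g x) powr p" for x
  proof -
    have "norm (f x + g x) powr p \<le> (2 * max (norm (f x)) (norm (g x))) powr p"
      using norm_triangle_ineq[of "f x" "g x"] p by (intro powr_mono2) auto
    also have "\<dots> \<le> 2 powr p * norm (f x) powr p + 2 powr p * norm (g x) powr p"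
      by (simp add: powr_mult max_def)
    finally show ?thesis .
  qed
  have "integrable lebesgue (\<lambda>x. norm (f x + g x) powr p)"
  proof (rule Bochner_Integration.integrable_bound)
    show "integrable lebesgue (\<lambda>x. 2 powr p * norm (f x) powr p + 2 powr p * norm (g x) powr p)"
      using f g by (simp add: Lp_space_def)
    show "(\<lambda>x. norm (f x + g x) powr p) \<in> borel_measurable lebesgue" using m by measurable
    show "AE x in lebesgue. norm (norm (f x + g x) powr p) \<le> norm (2 powr p * norm (f x) powr p + 2 powr p * norm (g x) powr p)"
      by (rule AE_I2) (use b in \<open>auto intro: order_trans abs_ge_self\<close>)
  qed
  with m show ?thesis by (simp add: Lp_space_def)
qed

lemma norm_vector_smult: "norm (c *s v) = norm c * norm v" for v :: "complex ^ 'n"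
proof -
  have "norm (c *s v) = L2_set (\<lambda>i. norm c * norm (v $ i)) UNIV"
    by (simp add: norm_vec_def norm_mult)
  then show ?thesis by (simp add: norm_vec_def L2_set_right_distrib)
qed

lemma bounded_linear_vector_smult: "bounded_linear (\<lambda>v :: complex ^ 'n. c *s v)"
  by (rule bounded_linear_intro[where K="norm c"])
     (simp_all add: vector_add_ldistrib vec_eq_iff norm_vector_smult algebra_simps)

lemma Lp_space_smult:
  assumes f: "f \<in> Lp_space p"
  shows "(\<lambda>x. c *s f x) \<in> Lp_space p"
proof -
  have "(\<lambda>x. c *s f x) \<in> borel_measurable lebesgue"
    using f bounded_linear.continuous_on[OF bounded_linear_vector_smult[of c] continuous_on_id]
    by (auto simp: Lp_space_def intro: borel_measurable_continuous_on[where f="\<lambda>v. c *s v"])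
  then show ?thesis
    using f by (simp add: Lp_space_def norm_vector_smult powr_mult)
qed

section \<open>The Dirac system\<close>

lemma has_ac_derivative_vec2:
  fixes u :: "real \<Rightarrow> complex ^ 2"
  assumes "has_ac_derivative (\<lambda>x. u x $ 1) d1" and "has_ac_derivative (\<lambda>x. u x $ 2) d2"
  shows "has_ac_derivative u (\<lambda>x. vector [d1 x, d2 x])"
proof -
  have bl: "bounded_linear (axis i :: complex \<Rightarrow> complex ^ 2)" for i
    by (auto simp: linear_conv_bounded_linear[symmetric] vec_eq_iff axis_def intro!: linearI)
  have eq: "axis 1 (v $ 1) + axis 2 (v $ 2) = v" "axis 1 b + axis 2 c = (vector [b, c] :: complex ^ 2)" for v :: "complex ^ 2" and b c
    by (simp_all add: vec_eq_iff axis_def forall_2)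
  show ?thesis
    using has_ac_derivative_add[OF has_ac_derivative_bounded_linear[OF assms(1) bl[of 1]]
      has_ac_derivative_bounded_linear[OF assms(2) bl[of 2]]]
    unfolding eq(1) unfolding eq(2) .
qed

text \<open>The equation \<open>(H\<^sub>0 - z) u = f\<close> solved for the derivatives of the components of \<open>u\<close>.\<close>

definition dirac_ode ::
  "real \<Rightarrow> (real \<Rightarrow> real) \<Rightarrow> complex \<Rightarrow> (real \<Rightarrow> complex ^ 2) \<Rightarrow> (real \<Rightarrow> complex ^ 2) \<Rightarrow> bool" where
  "dirac_ode m q z u f \<longleftrightarrow>
    has_ac_derivative (\<lambda>x. u x $ 1) (\<lambda>x. (z - of_real (q x) + of_real m) * u x $ 2 + f x $ 2) \<and>
    has_ac_derivative (\<lambda>x. u x $ 2) (\<lambda>x. (of_real m + of_real (q x) - z) * u x $ 1 - f x $ 1)"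

text \<open>The matrix \<open>- \<i> sigma2\<close> is the real rotation with rows
  \<open>(0, -1)\<close> and \<open>(1, 0)\<close>, so each row of the system contains just one
  derivative.\<close>

lemma dirac_expression_eq_iff:
  fixes u u' f :: "complex ^ 2"
  shows "(- \<i>) *s (sigma2 *v u') + dirac_potential m q x *v u = f + z *s u \<longleftrightarrow>
    u' $ 1 = (z - of_real (q x) + of_real m) * u $ 2 + f $ 2 \<and>
    u' $ 2 = (of_real m + of_real (q x) - z) * u $ 1 - f $ 1"
proof -
  let ?L = "(- \<i>) *s (sigma2 *v u') + dirac_potential m q x *v u"
  have "?L $ 1 = - u' $ 2 + (of_real m + of_real (q x)) * u $ 1"
    "?L $ 2 = u' $ 1 + (of_real (q x) - of_real m) * u $ 2"
    by (simp_all add: sigma2_def sigma3_def dirac_potential_def matrix_vector_mult_def sum_2 mat_def,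
        simp_all add: scaleR_conv_of_real algebra_simps)
  then have "?L = f + z *s u \<longleftrightarrow> - u' $ 2 + (of_real m + of_real (q x)) * u $ 1 = f $ 1 + z * u $ 1 \<and>
    u' $ 1 + (of_real (q x) - of_real m) * u $ 2 = f $ 2 + z * u $ 2"
    by (simp only: vec_eq_iff forall_2 vector_add_component vector_smult_component)
  also have "\<dots> \<longleftrightarrow> u' $ 1 = (z - of_real (q x) + of_real m) * u $ 2 + f $ 2 \<and>
    u' $ 2 = (of_real m + of_real (q x) - z) * u $ 1 - f $ 1"
    by (auto simp: algebra_simps eq_diff_eq add_eq_0_iff)
  finally show ?thesis .
qed

text \<open>Altering a derivative on a null set is harmless. Hence the existentially quantified
  \<open>u'\<close> can be replaced by the right-hand sides of the solved equations, and conversely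
  these serve as \<open>u'\<close> at every point.\<close>

lemma dirac_graph_iff_ode:
  "(u, \<lambda>x. f x + z *s u x) \<in> dirac_graph m q \<longleftrightarrow>
    u \<in> Lp_space 2 \<and> (\<lambda>x. f x + z *s u x) \<in> Lp_space 2 \<and> dirac_ode m q z u f"
proof -
  have "(\<exists>u'. has_ac_derivative u u' \<and>
       (AE x in lebesgue. (- \<i>) *s (sigma2 *v u' x) + dirac_potential m q x *v u x = f x + z *s u x))
     \<longleftrightarrow> dirac_ode m q z u f" (is "?L \<longleftrightarrow> ?R")
  proof
    assume ?L
    then obtain u' where u': "has_ac_derivative u u'"
      "AE x in lebesgue. u' x $ 1 = (z - of_real (q x) + of_real m) * u x $ 2 + f x $ 2 \<and>
        u' x $ 2 = (of_real m + of_real (q x) - z) * u x $ 1 - f x $ 1"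
      unfolding dirac_expression_eq_iff by blast
    show ?R unfolding dirac_ode_def
    proof
      show "has_ac_derivative (\<lambda>x. u x $ 1) (\<lambda>x. (z - of_real (q x) + of_real m) * u x $ 2 + f x $ 2)"
        by (rule has_ac_derivative_cong_AE[OF has_ac_derivative_bounded_linear[OF u'(1) bounded_linear_vec_nth]])
           (use u'(2) in eventually_elim, simp)
      show "has_ac_derivative (\<lambda>x. u x $ 2) (\<lambda>x. (of_real m + of_real (q x) - z) * u x $ 1 - f x $ 1)"
        by (rule has_ac_derivative_cong_AE[OF has_ac_derivative_bounded_linear[OF u'(1) bounded_linear_vec_nth]])
           (use u'(2) in eventually_elim, simp)
    qed
  next
    assume ?R
    then have "has_ac_derivative u (\<lambda>x. vector [(z - of_real (q x) + of_real m) * u x $ 2 + f x $ 2,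
        (of_real m + of_real (q x) - z) * u x $ 1 - f x $ 1])"
      unfolding dirac_ode_def by (intro has_ac_derivative_vec2) auto
    then show ?L
      unfolding dirac_expression_eq_iff by (intro exI conjI, assumption) simp
  qed
  then show ?thesis unfolding dirac_graph_def mem_Collect_eq prod.case by (simp only: simp_thms)
qed

lemma dirac_ode_continuous:
  assumes "dirac_ode m q z u f"
  shows "continuous_on A u"
  by (rule has_ac_derivative_continuous[OF has_ac_derivative_vec2])
     (use assms in \<open>auto simp only: dirac_ode_def\<close>)

lemma has_ac_derivative_eq_rhs: "has_ac_derivative u d \<Longrightarrow> (\<And>x. d x = d' x) \<Longrightarrow> has_ac_derivative u d'"
  by (metis ext)

lemma dirac_ode_diff:
  assumes "dirac_ode m q z u f" "dirac_ode m q z v g"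
  shows "dirac_ode m q z (\<lambda>x. u x - v x) (\<lambda>x. f x - g x)"
  unfolding dirac_ode_def vector_minus_component
  by (intro conjI; rule has_ac_derivative_eq_rhs, rule has_ac_derivative_diff)
     (use assms in \<open>auto simp: dirac_ode_def algebra_simps\<close>)

lemma dirac_ode_shift:
  assumes "dirac_ode m q z u (\<lambda>_. 0)" "\<And>x. q (x + a) = q x"
  shows "dirac_ode m q z (\<lambda>x. u (x + a)) (\<lambda>_. 0)"
  using assms(1)[unfolded dirac_ode_def, THEN conjunct1, THEN has_ac_derivative_shift, of a]
    assms(1)[unfolded dirac_ode_def, THEN conjunct2, THEN has_ac_derivative_shift, of a]
  unfolding dirac_ode_def by (simp add: assms(2))

lemma fundamental_system_ode:
  assumes "is_fundamental_system m q \<Phi>"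
  shows "dirac_ode m q z (\<lambda>x. \<Phi> x z *v v) (\<lambda>_. 0)"
proof -
  from assms obtain \<Phi>' where P: "has_ac_derivative (\<lambda>x. \<Phi> x z) \<Phi>'"
    "AE x in lebesgue. mat (- \<i>) ** sigma2 ** \<Phi>' x + dirac_potential m q x ** \<Phi> x z = mat z ** \<Phi> x z"
    unfolding is_fundamental_system_def by blast
  have scal: "mat c *v w = c *s w" for c :: complex and w :: "complex ^ 2"
    by (simp add: vec_eq_iff forall_2 matrix_vector_mult_def sum_2 mat_def)
  have ae: "AE x in lebesgue. (\<Phi>' x *v v) $ 1 = (z - of_real (q x) + of_real m) * (\<Phi> x z *v v) $ 2 + 0 \<and>
      (\<Phi>' x *v v) $ 2 = (of_real m + of_real (q x) - z) * (\<Phi> x z *v v) $ 1 - 0"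
    using P(2)
  proof eventually_elim
    case (elim x)
    then have "(mat (- \<i>) ** sigma2 ** \<Phi>' x + dirac_potential m q x ** \<Phi> x z) *v v = (mat z ** \<Phi> x z) *v v"
      by simp
    then have "(- \<i>) *s (sigma2 *v (\<Phi>' x *v v)) + dirac_potential m q x *v (\<Phi> x z *v v) = 0 + z *s (\<Phi> x z *v v)"
      by (simp add: matrix_vector_mult_add_rdistrib scal matrix_mul_assoc[symmetric] matrix_vector_mul_assoc[symmetric])
    then show ?case unfolding dirac_expression_eq_iff by simp
  qed
  have bl: "bounded_linear (\<lambda>A :: complex^2^2. (A *v v) $ i)" for i
    by (auto simp: linear_conv_bounded_linear[symmetric] matrix_vector_mult_def scaleR_sum_right
        distrib_right sum.distrib intro!: linearI)
  show ?thesis unfolding dirac_ode_def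
    by (intro conjI; rule has_ac_derivative_cong_AE[OF has_ac_derivative_bounded_linear[OF P(1) bl]])
       (use ae in \<open>eventually_elim, simp\<close>)+
qed

section \<open>Wronskians and the fundamental system\<close>

lemma det_columns_eq: "det_columns v w = v $ 1 * w $ 2 - w $ 1 * v $ 2"
  by (simp add: det_columns_def det_2 transpose_def)

text \<open>This is the Wronskian. The coefficient matrix of the first-order system has zero
  diagonal, so all terms of the product rule cancel.\<close>

lemma det_columns_constant:
  assumes u: "dirac_ode m q z u (\<lambda>_. 0)" and v: "dirac_ode m q z v (\<lambda>_. 0)"
  shows "det_columns (u x) (v x) = det_columns (u y) (v y)"
proof -
  have "has_ac_derivative (\<lambda>x. det_columns (u x) (v x)) (\<lambda>_. 0)"
    unfolding det_columns_eq
    using u v unfolding dirac_ode_def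
    by (elim conjE) (rule has_ac_derivative_eq_rhs,
        rule has_ac_derivative_diff[OF has_ac_derivative_mult has_ac_derivative_mult],
        assumption+, simp add: algebra_simps)
  from has_ac_derivative_integral[OF this] have "x \<le> y \<Longrightarrow> det_columns (u y) (v y) = det_columns (u x) (v x)" for x y
    by simp
  then show ?thesis by (metis linear)
qed

text \<open>Cramer's rule in the form
  \<open>det(u, v) w = det(w, v) u - det(w, u) v\<close>.\<close>

lemma det_columns_eq_0_imp_0:
  assumes "det_columns w u = 0" "det_columns w v = 0" "det_columns u v \<noteq> 0"
  shows "w = 0"
proof -
  have "w $ 1 * det_columns u v = u $ 1 * det_columns w v - v $ 1 * det_columns w u"
    "w $ 2 * det_columns u v = u $ 2 * det_columns w v - v $ 2 * det_columns w u"
    by (simp_all add: det_columns_eq algebra_simps)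
  then show ?thesis using assms by (simp add: vec_eq_iff forall_2)
qed

lemma det_columns_matrix_mult: "det_columns (A *v u) (A *v v) = det A * det_columns u v"
  by (simp add: det_columns_eq det_2 matrix_vector_mult_def sum_2 algebra_simps)

lemma det_fundamental_system:
  assumes "is_fundamental_system m q \<Phi>"
  shows "det (\<Phi> x z) = 1"
proof -
  have "det_columns (\<Phi> x z *v axis 1 1) (\<Phi> x z *v axis 2 1) = det_columns (\<Phi> 0 z *v axis 1 1) (\<Phi> 0 z *v axis 2 1)"
    by (rule det_columns_constant; rule fundamental_system_ode[OF assms])
  then show ?thesis
    using assms by (simp add: det_columns_matrix_mult is_fundamental_system_def) (simp add: det_columns_eq axis_def)
qed

text \<open>The difference of the two solutions vanishes at 0, so its Wronskians with both columns
  of \<open>\<Phi>\<close> vanish everywhere; as these columns are independent, the difference is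
  zero.\<close>

lemma dirac_ode_eq_fundamental_system:
  assumes \<Phi>: "is_fundamental_system m q \<Phi>" and u: "dirac_ode m q z u (\<lambda>_. 0)"
  shows "u x = \<Phi> x z *v u 0"
proof -
  let ?w = "\<lambda>x. u x - \<Phi> x z *v u 0"
  have w: "dirac_ode m q z ?w (\<lambda>_. 0)"
    using dirac_ode_diff[OF u fundamental_system_ode[OF \<Phi>]] by simp
  have w0: "?w 0 = 0" using \<Phi> by (simp add: is_fundamental_system_def)
  have "det_columns (?w x) (\<Phi> x z *v v) = 0" for v
    using det_columns_constant[OF w fundamental_system_ode[OF \<Phi>], of x v 0] unfolding w0
    by (simp add: det_columns_eq)
  then have "det_columns (?w x) (\<Phi> x z *v axis 1 1) = 0" "det_columns (?w x) (\<Phi> x z *v axis 2 1) = 0"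
    by this+
  moreover have "det_columns (\<Phi> x z *v axis 1 1) (\<Phi> x z *v axis 2 1) \<noteq> 0"
    unfolding det_columns_matrix_mult det_fundamental_system[OF \<Phi>] by (simp add: det_columns_eq axis_def)
  ultimately have "?w x = 0" by (rule det_columns_eq_0_imp_0)
  then show ?thesis by simp
qed

text \<open>The translate by a period solves the same equation, hence is determined by its value at
  0, which is the monodromy matrix applied to \<open>v\<close>.\<close>

lemma fundamental_system_monodromy:
  assumes \<Phi>: "is_fundamental_system m q \<Phi>" and q: "\<And>x. q (x + a) = q x"
  shows "\<Phi> (x + a) z *v v = \<Phi> x z *v (monodromy a \<Phi> z *v v)"
  using dirac_ode_eq_fundamental_system[OF \<Phi> dirac_ode_shift[OF fundamental_system_ode[OF \<Phi>, of z v] q], where x=x]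
  unfolding monodromy_def add_0_left .

text \<open>The characteristic polynomial of a matrix of determinant 1 is
  \<open>\<rho>\<^sup>2 - trace A * \<rho> + 1\<close>. That it vanishes at \<open>\<rho>\<close> is
  checked by multiplying \<open>(\<rho> - A) v = 0\<close> with the adjugate, which gives
  \<open>?p\<close> times each component of \<open>v\<close>.\<close>

lemma trace_eq_of_eigenvector:
  assumes "is_eigenvector A \<rho> v" "det A = 1" "\<rho> \<noteq> 0"
  shows "trace A = \<rho> + 1 / \<rho>"
proof -
  have e: "A$1$1 * v$1 + A$1$2 * v$2 = \<rho> * v$1" "A$2$1 * v$1 + A$2$2 * v$2 = \<rho> * v$2"
    using assms(1) by (simp_all add: is_eigenvector_def vec_eq_iff forall_2 matrix_vector_mult_def sum_2)
  have d: "A$1$1 * A$2$2 = 1 + A$1$2 * A$2$1" using assms(2) by (simp add: det_2 algebra_simps)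
  let ?p = "\<rho>\<^sup>2 - (A$1$1 + A$2$2) * \<rho> + 1"
  have p: "?p = (\<rho> - A$1$1) * (\<rho> - A$2$2) - A$1$2 * A$2$1"
    using d by (simp add: algebra_simps power2_eq_square)
  have e': "A$1$2 * v$2 = (\<rho> - A$1$1) * v$1" "A$2$1 * v$1 = (\<rho> - A$2$2) * v$2"
    using e by (simp_all add: algebra_simps)
  have "?p * v$1 = (\<rho> - A$2$2) * ((\<rho> - A$1$1) * v$1) - A$1$2 * (A$2$1 * v$1)"
    unfolding p by (simp add: algebra_simps)
  also have "\<dots> = 0"
    unfolding e'(2) e'(1)[symmetric] by simp
  finally have p1: "?p * v$1 = 0" .
  have "?p * v$2 = (\<rho> - A$1$1) * ((\<rho> - A$2$2) * v$2) - A$2$1 * (A$1$2 * v$2)"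
    unfolding p by (simp add: algebra_simps)
  also have "\<dots> = 0"
    unfolding e'(1) e'(2)[symmetric] by simp
  finally have "?p * v$2 = 0" .
  note p1 this
  moreover have "v$1 \<noteq> 0 \<or> v$2 \<noteq> 0"
    using assms(1) by (auto simp: is_eigenvector_def vec_eq_iff forall_2)
  ultimately have "?p = 0" by auto
  then have "(A$1$1 + A$2$2) * \<rho> = \<rho>\<^sup>2 + 1" by (simp add: algebra_simps)
  then show ?thesis
    using assms(3) by (simp add: trace_def sum_2 field_simps power2_eq_square)
qed

text \<open>A value in the segment is twice the cosine of a real \<open>arccos\<close>, and two
  arguments with equal cosine agree up to sign and a real period.\<close>

lemma cos_in_real_segment_iff: "2 * cos w \<in> complex_of_real ` {-2..2} \<longleftrightarrow> Im w = 0"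
proof
  assume "2 * cos w \<in> complex_of_real ` {-2..2}"
  then obtain s where s: "-2 \<le> s" "s \<le> 2" "2 * cos w = complex_of_real s" by auto
  have "cos w = of_real (s / 2)" using s(3) by (simp add: field_simps)
  also have "s / 2 = cos (arccos (s / 2))" using s by (simp add: cos_arccos)
  finally have "cos w = cos (complex_of_real (arccos (s / 2)))" by (simp only: cos_of_real)
  then obtain n where "n \<in> \<int>" "w = of_real (arccos (s / 2)) + of_real (2 * n * pi) \<or> w = - of_real (arccos (s / 2)) + of_real (2 * n * pi)"
    unfolding complex_cos_eq by blast
  then show "Im w = 0" by auto
next
  assume "Im w = 0"
  then have "w = of_real (Re w)" by (simp add: complex_eq_iff)
  then have "cos w = cos (of_real (Re w))" by (rule arg_cong)
  then have "cos w = of_real (cos (Re w))" unfolding cos_of_real .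
  then have "2 * cos w = of_real (2 * cos (Re w))" by simp
  moreover have "2 * cos (Re w) \<in> {-2..2}" using cos_le_one[of "Re w"] cos_ge_minus_one[of "Re w"] by simp
  ultimately show "2 * cos w \<in> complex_of_real ` {-2..2}" by blast
qed

lemma det_columns_eigenvectors:
  assumes v: "is_eigenvector A \<rho> v" and w: "is_eigenvector A \<sigma> w" and "\<rho> \<noteq> \<sigma>"
  shows "det_columns v w \<noteq> 0"
proof
  assume d: "det_columns v w = 0"
  have "v \<noteq> 0" "w \<noteq> 0" using v w by (auto simp: is_eigenvector_def)
  \<comment> \<open>Linear dependence is expressed without division, so it need not be known which
    coordinates are nonzero.\<close>
  have "w $ i *s v = v $ i *s w" for i
    using d exhaust_2[of i] by (auto simp: det_columns_eq vec_eq_iff forall_2 mult.commute)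
  then have "A *v (w $ i *s v) = A *v (v $ i *s w)" for i by simp
  then have eq: "w $ i *s (\<rho> *s v) = v $ i *s (\<sigma> *s w)" for i
    using v w by (simp add: is_eigenvector_def vector_scalar_commute)
  have z: "w $ i * v $ i = 0" for i
  proof -
    have "w $ i * (\<rho> * v $ i) = v $ i * (\<sigma> * w $ i)"
      using arg_cong[OF eq[of i], of "\<lambda>u. u $ i"] by simp
    then have "(\<rho> - \<sigma>) * (w $ i * v $ i) = 0" by (simp add: algebra_simps)
    then show ?thesis using \<open>\<rho> \<noteq> \<sigma>\<close> by simp
  qed
  have "v $ 1 = 0 \<and> v $ 2 = 0 \<or> w $ 1 = 0 \<and> w $ 2 = 0"
    using z[of 1] z[of 2] d by (auto simp: det_columns_eq)
  then show False
    using \<open>v \<noteq> 0\<close> \<open>w \<noteq> 0\<close> by (auto simp: vec_eq_iff forall_2)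
qed

section \<open>Floquet solutions\<close>

lemma continuous_periodic_bounded:
  fixes f :: "real \<Rightarrow> 'b::real_normed_vector"
  assumes a: "a > 0" and per: "\<And>x. f (x + a) = f x" and cont: "continuous_on UNIV f"
  shows "bdd_above (range (\<lambda>x. norm (f x)))"
proof -
  interpret periodic_fun_simple f a
    by unfold_locales (rule per)
  have "bounded (f ` {0..a})"
    by (rule compact_imp_bounded[OF compact_continuous_image[OF continuous_on_subset[OF cont]]]) auto
  then obtain B where B: "\<forall>y \<in> f ` {0..a}. norm y \<le> B"
    unfolding bounded_iff by blast
  have "norm (f x) \<le> B" for x
  proof -
    define n where "n = \<lfloor>x / a\<rfloor>"
    have "of_int n \<le> x / a" "x / a \<le> of_int n + 1" unfolding n_def by linarith+
    then have "0 \<le> x - of_int n * a" "x - of_int n * a \<le> a"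
      using a by (simp_all add: field_simps)
    moreover have "f (x - of_int n * a) = f x" by (rule minus_of_int)
    ultimately show ?thesis using B by (metis atLeastAtMost_iff imageI)
  qed
  then show ?thesis by (intro bdd_aboveI[of _ B]) auto
qed

lemma continuous_imp_lebesgue_measurable:
  fixes f :: "real \<Rightarrow> 'b::euclidean_space"
  shows "continuous_on UNIV f \<Longrightarrow> f \<in> borel_measurable lebesgue"
  using continuous_imp_measurable_on_sets_lebesgue[of UNIV f] by (simp add: lebesgue_on_UNIV_eq)

lemma norm_vec2_complex: "norm (v :: complex ^ 2) = sqrt ((cmod (v $ 1))\<^sup>2 + (cmod (v $ 2))\<^sup>2)"
  by (simp add: norm_vec_def L2_set_def sum_2)

text \<open>Cauchy-Schwarz for the form without conjugation, as it arises from the plain transpose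
  in the kernel.\<close>

lemma norm_bilinear_form_le:
  fixes v w :: "complex ^ 2"
  shows "cmod (v $ 1 * w $ 1 + v $ 2 * w $ 2) \<le> norm v * norm w"
proof -
  have "cmod (v $ 1 * w $ 1 + v $ 2 * w $ 2) \<le> (\<Sum>i\<in>UNIV. \<bar>cmod (v $ i)\<bar> * \<bar>cmod (w $ i)\<bar>)"
    using norm_triangle_ineq[of "v $ 1 * w $ 1" "v $ 2 * w $ 2"] by (simp add: sum_2 norm_mult)
  also have "\<dots> \<le> norm v * norm w"
    unfolding norm_vec_def by (rule L2_set_mult_ineq)
  finally show ?thesis .
qed

text \<open>The determinant is the bilinear form of \<open>v\<close> with \<open>w\<close> turned by
  a right angle.\<close>

lemma cmod_det_columns_le: "cmod (det_columns v w) \<le> norm v * norm w"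
proof -
  have "norm (vector [w $ 2, - (w $ 1)] :: complex ^ 2) = norm w"
    by (simp add: norm_vec2_complex add.commute)
  then show ?thesis
    using norm_bilinear_form_le[of v "vector [w $ 2, - (w $ 1)]"] by (simp add: det_columns_eq mult.commute)
qed

lemma mat_outer_mult: "(mat c ** outer v w) *v u = (c * (w $ 1 * u $ 1 + w $ 2 * u $ 2)) *s v"
  by (simp add: vec_eq_iff forall_2 matrix_vector_mult_def matrix_matrix_mult_def outer_def mat_def sum_2 algebra_simps)

lemma frobenius_norm_mat_outer: "frobenius_norm (mat c ** outer v w) = cmod c * (norm v * norm w)"
proof -
  have "(\<Sum>i\<in>UNIV. \<Sum>j\<in>UNIV. (cmod ((mat c ** outer v w) $ i $ j))\<^sup>2)
     = (cmod c)\<^sup>2 * (((cmod (v $ 1))\<^sup>2 + (cmod (v $ 2))\<^sup>2) * ((cmod (w $ 1))\<^sup>2 + (cmod (w $ 2))\<^sup>2))"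
    by (simp add: matrix_matrix_mult_def outer_def mat_def sum_2 norm_mult power_mult_distrib algebra_simps)
  then show ?thesis
    unfolding frobenius_norm_def norm_vec2_complex by (simp add: real_sqrt_mult)
qed

text \<open>A positive lower bound on windows of every length makes the integral exceed every
  multiple of it. Windows with free position allow the use at both ends of the line.\<close>

lemma lower_bound_integrable_imp_nonpos:
  fixes F :: "real \<Rightarrow> real"
  assumes F: "integrable lebesgue F" "\<And>t. F t \<ge> 0"
    and le: "\<And>n. \<exists>s. \<forall>t\<in>{s..s + real n}. c \<le> F t"
  shows "c \<le> 0"
proof (rule ccontr)
  assume "\<not> c \<le> 0"
  then have c: "c > 0" by simp
  have "real n * c \<le> integral\<^sup>L lebesgue F" for n
  proof -
    obtain s where s: "\<And>t. t \<in> {s..s + real n} \<Longrightarrow> c \<le> F t" using le by blast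
    have b: "has_bochner_integral lebesgue (\<lambda>t. indicator {s..s + real n} t *\<^sub>R c) (measure lebesgue {s..s + real n} *\<^sub>R c)"
      by (rule has_bochner_integral_indicator) auto
    then have "real n * c = (LINT t|lebesgue. indicator {s..s + real n} t *\<^sub>R c)"
      by (simp add: has_bochner_integral_integral_eq)
    also have "\<dots> \<le> integral\<^sup>L lebesgue F"
      by (rule integral_mono) (use b F s in \<open>auto simp: has_bochner_integral_iff indicator_def\<close>)
    finally show ?thesis .
  qed
  moreover obtain n where "integral\<^sup>L lebesgue F / c < real n"
    using reals_Archimedean2 by blast
  ultimately show False using c by (smt (verit) pos_divide_less_eq mult.commute)
qed

lemma continuous_on_smult:
  fixes c :: "'a::topological_space \<Rightarrow> complex" and v :: "'a \<Rightarrow> complex ^ 'n"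
  assumes "continuous_on A c" "continuous_on A v"
  shows "continuous_on A (\<lambda>x. c x *s v x)"
  unfolding vector_scalar_mult_def
  by (intro continuous_on_vec_lambda continuous_intros assms)

text \<open>The sign of \<open>Im (k z)\<close> is left open, so that the resolvent set and the
  spectrum are treated from the same data.\<close>

locale floquet =
  fixes m a :: real and q :: "real \<Rightarrow> real" and \<Phi> :: "real \<Rightarrow> complex \<Rightarrow> complex ^ 2 ^ 2"
    and k :: "complex \<Rightarrow> complex" and z :: complex and vp vm :: "complex ^ 2"
  assumes a_pos: "a > 0" and q_periodic: "\<And>x. q (x + a) = q x"
    and fundamental: "is_fundamental_system m q \<Phi>"
    and eigenvector_plus: "is_eigenvector (monodromy a \<Phi> z) (exp (- \<i> * k z * of_real a)) vp"
    and eigenvector_minus: "is_eigenvector (monodromy a \<Phi> z) (exp (\<i> * k z * of_real a)) vm"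
begin

abbreviation "up x \<equiv> \<Phi> x z *v vp"
abbreviation "um x \<equiv> \<Phi> x z *v vm"
abbreviation "pp x \<equiv> phi_plus \<Phi> k vp x z"
abbreviation "pm x \<equiv> phi_minus \<Phi> k vm x z"
abbreviation "W \<equiv> det_columns vp vm"
abbreviation "\<kappa> \<equiv> Im (k z)"

lemma up_ode: "dirac_ode m q z up (\<lambda>_. 0)" and um_ode: "dirac_ode m q z um (\<lambda>_. 0)"
  by (rule fundamental_system_ode[OF fundamental])+

lemma det_columns_up_um: "det_columns (up x) (um x) = W"
  by (simp add: det_columns_matrix_mult det_fundamental_system[OF fundamental])

text \<open>Over one period the exponential gains the factor \<open>exp (\<i> k a)\<close>, the
  inverse of the Floquet multiplier of \<open>vp\<close>.\<close>

lemma phi_plus_periodic: "pp (x + a) = pp x"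
proof -
  have "pp (x + a) = exp (\<i> * k z * of_real (x + a)) *s (\<Phi> x z *v (exp (- \<i> * k z * of_real a) *s vp))"
    using eigenvector_plus
    by (simp add: phi_plus_def fundamental_system_monodromy[OF fundamental q_periodic] is_eigenvector_def)
  also have "\<dots> = (exp (\<i> * k z * of_real (x + a)) * exp (- \<i> * k z * of_real a)) *s up x"
    by (simp add: vector_scalar_commute[symmetric] vector_smult_assoc)
  also have "exp (\<i> * k z * of_real (x + a)) * exp (- \<i> * k z * of_real a) = exp (\<i> * k z * of_real x)"
    by (simp add: exp_add[symmetric] algebra_simps)
  finally show ?thesis by (simp add: phi_plus_def)
qed

lemma phi_minus_periodic: "pm (x + a) = pm x"
proof -
  have "pm (x + a) = exp (- \<i> * k z * of_real (x + a)) *s (\<Phi> x z *v (exp (\<i> * k z * of_real a) *s vm))"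
    using eigenvector_minus
    by (simp add: phi_minus_def fundamental_system_monodromy[OF fundamental q_periodic] is_eigenvector_def)
  also have "\<dots> = (exp (- \<i> * k z * of_real (x + a)) * exp (\<i> * k z * of_real a)) *s um x"
    by (simp add: vector_scalar_commute[symmetric] vector_smult_assoc)
  also have "exp (- \<i> * k z * of_real (x + a)) * exp (\<i> * k z * of_real a) = exp (- \<i> * k z * of_real x)"
    by (simp add: exp_add[symmetric] algebra_simps)
  finally show ?thesis by (simp add: phi_minus_def)
qed

text \<open>Without boundedness \<open>SUP\<close> would carry no information; it follows here from
  continuity and periodicity.\<close>

lemma phi_plus_le_sup_norm: "norm (pp x) \<le> sup_norm pp"
  and phi_minus_le_sup_norm: "norm (pm x) \<le> sup_norm pm"
proof -
  have "continuous_on UNIV pp"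
    unfolding phi_plus_def by (intro continuous_on_smult continuous_intros dirac_ode_continuous[OF up_ode])
  then have "bdd_above (range (\<lambda>x. norm (pp x)))"
    by (rule continuous_periodic_bounded[where f=pp, OF a_pos phi_plus_periodic])
  then show "norm (pp x) \<le> sup_norm pp"
    unfolding sup_norm_def by (rule cSUP_upper[OF UNIV_I])
  have "continuous_on UNIV pm"
    unfolding phi_minus_def by (intro continuous_on_smult continuous_intros dirac_ode_continuous[OF um_ode])
  then have "bdd_above (range (\<lambda>x. norm (pm x)))"
    by (rule continuous_periodic_bounded[where f=pm, OF a_pos phi_minus_periodic])
  then show "norm (pm x) \<le> sup_norm pm"
    unfolding sup_norm_def by (rule cSUP_upper[OF UNIV_I])
qed

lemma sup_norms_nonneg: "sup_norm pp \<ge> 0" "sup_norm pm \<ge> 0"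
  using order_trans[OF norm_ge_zero phi_plus_le_sup_norm] order_trans[OF norm_ge_zero phi_minus_le_sup_norm] by auto

lemma norm_up: "norm (up x) = exp (\<kappa> * x) * norm (pp x)"
  and norm_um: "norm (um x) = exp (- \<kappa> * x) * norm (pm x)"
  by (simp_all add: phi_plus_def phi_minus_def norm_vector_smult norm_exp_eq_Re mult.assoc[symmetric] exp_add[symmetric])

lemma norm_up_le: "norm (up x) \<le> sup_norm pp * exp (\<kappa> * x)"
  and norm_um_le: "norm (um x) \<le> sup_norm pm * exp (- \<kappa> * x)"
  unfolding norm_up norm_um
  using phi_plus_le_sup_norm phi_minus_le_sup_norm by (simp_all add: mult.commute)

text \<open>The exponential in \<open>\<bar>t - x\<bar>\<close> cancels those in
  \<open>phi_plus\<close> and \<open>phi_minus\<close>. What remains is the classical kernel made of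
  the solutions themselves, to which variation of constants applies; for the norm the periodic
  factors are kept.\<close>

lemma green_gt:
  assumes "t > x"
  shows "green \<Phi> k vp vm x t z *v w = (- (um t $ 1 * w $ 1 + um t $ 2 * w $ 2) / W) *s up x"
    and "frobenius_norm (green \<Phi> k vp vm x t z) = exp (- \<kappa> * \<bar>t - x\<bar>) / cmod W * (norm (pp x) * norm (pm t))"
proof -
  have g: "green \<Phi> k vp vm x t z = mat (- (exp (\<i> * k z * of_real \<bar>t - x\<bar>) / W)) ** outer (pp x) (pm t)"
    using assms by (simp add: green_def)
  have "exp (\<i> * k z * of_real \<bar>t - x\<bar>) * exp (\<i> * k z * of_real x) * exp (- \<i> * k z * of_real t) = 1"
    using assms by (simp add: exp_add[symmetric] algebra_simps)
  then have "- (exp (\<i> * k z * of_real \<bar>t - x\<bar>) / W) * (exp (- \<i> * k z * of_real t) * s) * exp (\<i> * k z * of_real x) = - s / W" for s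
    by (simp add: field_simps)
  note e = this[of "um t $ 1 * w $ 1 + um t $ 2 * w $ 2"]
  show "green \<Phi> k vp vm x t z *v w = (- (um t $ 1 * w $ 1 + um t $ 2 * w $ 2) / W) *s up x"
    unfolding g mat_outer_mult e[symmetric]
    by (simp add: phi_plus_def phi_minus_def vector_smult_assoc algebra_simps)
  show "frobenius_norm (green \<Phi> k vp vm x t z) = exp (- \<kappa> * \<bar>t - x\<bar>) / cmod W * (norm (pp x) * norm (pm t))"
    unfolding g frobenius_norm_mat_outer by (simp add: norm_divide norm_exp_eq_Re)
qed

lemma green_lt:
  assumes "t < x"
  shows "green \<Phi> k vp vm x t z *v w = (- (up t $ 1 * w $ 1 + up t $ 2 * w $ 2) / W) *s um x"
    and "frobenius_norm (green \<Phi> k vp vm x t z) = exp (- \<kappa> * \<bar>t - x\<bar>) / cmod W * (norm (pm x) * norm (pp t))"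
proof -
  have g: "green \<Phi> k vp vm x t z = mat (- (exp (\<i> * k z * of_real \<bar>t - x\<bar>) / W)) ** outer (pm x) (pp t)"
    using assms by (simp add: green_def)
  have "exp (\<i> * k z * of_real \<bar>t - x\<bar>) * exp (- \<i> * k z * of_real x) * exp (\<i> * k z * of_real t) = 1"
    using assms by (simp add: exp_add[symmetric] algebra_simps)
  then have "- (exp (\<i> * k z * of_real \<bar>t - x\<bar>) / W) * (exp (\<i> * k z * of_real t) * s) * exp (- \<i> * k z * of_real x) = - s / W" for s
    by (simp add: field_simps)
  note e = this[of "up t $ 1 * w $ 1 + up t $ 2 * w $ 2"]
  show "green \<Phi> k vp vm x t z *v w = (- (up t $ 1 * w $ 1 + up t $ 2 * w $ 2) / W) *s um x"
    unfolding g mat_outer_mult e[symmetric]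
    by (simp add: phi_plus_def phi_minus_def vector_smult_assoc algebra_simps)
  show "frobenius_norm (green \<Phi> k vp vm x t z) = exp (- \<kappa> * \<bar>t - x\<bar>) / cmod W * (norm (pm x) * norm (pp t))"
    unfolding g frobenius_norm_mat_outer by (simp add: norm_divide norm_exp_eq_Re)
qed

end

section \<open>The Green operator\<close>

locale floquet_gap = floquet +
  assumes Im_k_pos: "\<kappa> > 0"
begin

definition "C = sup_norm pp * sup_norm pm / cmod W"

text \<open>The two eigenvalues have moduli \<open>exp (\<kappa> a)\<close> and
  \<open>exp (- \<kappa> a)\<close>, which differ.\<close>

lemma det_columns_vp_vm: "W \<noteq> 0"
proof (rule det_columns_eigenvectors[OF eigenvector_plus eigenvector_minus])
  show "exp (- \<i> * k z * of_real a) \<noteq> exp (\<i> * k z * of_real a)"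
  proof
    assume "exp (- \<i> * k z * of_real a) = exp (\<i> * k z * of_real a)"
    then have "cmod (exp (- \<i> * k z * of_real a)) = cmod (exp (\<i> * k z * of_real a))"
      by (rule arg_cong)
    then show False
      using Im_k_pos a_pos by (simp add: norm_exp_eq_Re)
  qed
qed

lemma C_nonneg: "C \<ge> 0"
  unfolding C_def using sup_norms_nonneg by simp

lemma norm_green_mult_le:
  assumes "t \<noteq> x"
  shows "norm (green \<Phi> k vp vm x t z *v w) \<le> C * (exp (- \<kappa> * \<bar>t - x\<bar>) * norm w)"
proof -
  have aux: "norm ((- (v $ 1 * w $ 1 + v $ 2 * w $ 2) / W) *s u) \<le> (norm u * norm v) / cmod W * norm w" for u v :: "complex ^ 2"
  proof -
    have "norm ((- (v $ 1 * w $ 1 + v $ 2 * w $ 2) / W) *s u) = cmod (v $ 1 * w $ 1 + v $ 2 * w $ 2) / cmod W * norm u"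
      by (simp only: norm_vector_smult norm_divide norm_minus_cancel)
    also have "\<dots> \<le> norm v * norm w / cmod W * norm u"
      by (intro mult_right_mono divide_right_mono norm_bilinear_form_le) auto
    finally show ?thesis by (simp add: mult_ac)
  qed
  consider "t > x" | "t < x" using assms by linarith
  then show ?thesis
  proof cases
    case 1
    have "norm (up x) * norm (um t) \<le> (sup_norm pp * exp (\<kappa> * x)) * (sup_norm pm * exp (- \<kappa> * t))"
      by (intro mult_mono norm_up_le norm_um_le) (use sup_norms_nonneg in auto)
    also have "\<dots> = sup_norm pp * sup_norm pm * exp (- \<kappa> * \<bar>t - x\<bar>)"
      using 1 by (simp add: exp_add[symmetric] algebra_simps)
    finally have b: "norm (up x) * norm (um t) \<le> sup_norm pp * sup_norm pm * exp (- \<kappa> * \<bar>t - x\<bar>)" .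
    have "norm (green \<Phi> k vp vm x t z *v w) \<le> (norm (up x) * norm (um t)) / cmod W * norm w"
      unfolding green_gt(1)[OF 1] by (rule aux)
    also have "\<dots> \<le> (sup_norm pp * sup_norm pm * exp (- \<kappa> * \<bar>t - x\<bar>)) / cmod W * norm w"
      by (intro mult_right_mono divide_right_mono b) auto
    finally show ?thesis by (simp add: C_def mult_ac)
  next
    case 2
    have "norm (um x) * norm (up t) \<le> (sup_norm pm * exp (- \<kappa> * x)) * (sup_norm pp * exp (\<kappa> * t))"
      by (intro mult_mono norm_up_le norm_um_le) (use sup_norms_nonneg in auto)
    also have "\<dots> = sup_norm pp * sup_norm pm * exp (- \<kappa> * \<bar>t - x\<bar>)"
      using 2 by (simp add: exp_add[symmetric] algebra_simps)
    finally have b: "norm (um x) * norm (up t) \<le> sup_norm pp * sup_norm pm * exp (- \<kappa> * \<bar>t - x\<bar>)" .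
    have "norm (green \<Phi> k vp vm x t z *v w) \<le> (norm (um x) * norm (up t)) / cmod W * norm w"
      unfolding green_lt(1)[OF 2] by (rule aux)
    also have "\<dots> \<le> (sup_norm pp * sup_norm pm * exp (- \<kappa> * \<bar>t - x\<bar>)) / cmod W * norm w"
      by (intro mult_right_mono divide_right_mono b) auto
    finally show ?thesis by (simp add: C_def mult_ac)
  qed
qed

section \<open>Variation of constants and the mapping properties of the Green operator\<close>

context
  fixes r r' :: real and f :: "real \<Rightarrow> complex ^ 2"
  assumes r: "1 < r" "r \<le> 2" "r' = 1 / (1 - 1 / r)" and f: "f \<in> Lp_space r"
begin

private lemma f_component_measurable: "(\<lambda>t. f t $ i) \<in> borel_measurable lebesgue"
  and norm_f_integrable: "integrable lebesgue (\<lambda>t. norm (f t) powr r)"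
proof -
  have m: "f \<in> borel_measurable lebesgue"
    using f by (simp add: Lp_space_def)
  show "integrable lebesgue (\<lambda>t. norm (f t) powr r)"
    using f by (simp add: Lp_space_def)
  show "(\<lambda>t. f t $ i) \<in> borel_measurable lebesgue"
    by (rule borel_measurable_continuous_on[OF _ m]) (intro continuous_intros)
qed

text \<open>Convergence holds for every \<open>x\<close>, so the Green operator is defined pointwise
  and not just up to null sets.\<close>

lemma Lp_exp_integrable: "integrable lebesgue (\<lambda>t. exp (- \<kappa> * \<bar>t - x\<bar>) * norm (f t))"
  by (rule Young_exp_integrable[OF Im_k_pos r norm_ge_zero norm_f_integrable])

text \<open>A Floquet solution may grow in one direction, so the bound is required only on the ray
  \<open>A\<close>, where the decay matches the kernel.\<close>

private lemma tail_integrable: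
  fixes u :: "real \<Rightarrow> complex ^ 2"
  assumes u: "continuous_on UNIV u" and A: "A \<in> sets lebesgue"
    and b: "\<And>t. t \<in> A \<Longrightarrow> norm (u t) \<le> D * exp (- \<kappa> * \<bar>t - x\<bar>)"
  shows "set_integrable lebesgue A (\<lambda>t. u t $ 1 * f t $ 1 + u t $ 2 * f t $ 2)"
  unfolding set_integrable_def
proof (rule Bochner_Integration.integrable_bound)
  show "integrable lebesgue (\<lambda>t. D * (exp (- \<kappa> * \<bar>t - x\<bar>) * norm (f t)))"
    using Lp_exp_integrable by simp
  have um: "(\<lambda>t. u t $ i) \<in> borel_measurable lebesgue" for i
    by (intro continuous_imp_lebesgue_measurable continuous_intros u)
  show "(\<lambda>t. indicat_real A t *\<^sub>R (u t $ 1 * f t $ 1 + u t $ 2 * f t $ 2)) \<in> borel_measurable lebesgue"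
    by (intro borel_measurable_scaleR borel_measurable_indicator A borel_measurable_add borel_measurable_times um f_component_measurable)
  show "AE t in lebesgue. norm (indicat_real A t *\<^sub>R (u t $ 1 * f t $ 1 + u t $ 2 * f t $ 2))
      \<le> norm (D * (exp (- \<kappa> * \<bar>t - x\<bar>) * norm (f t)))"
  proof (rule AE_I2)
    fix t
    show "norm (indicat_real A t *\<^sub>R (u t $ 1 * f t $ 1 + u t $ 2 * f t $ 2))
      \<le> norm (D * (exp (- \<kappa> * \<bar>t - x\<bar>) * norm (f t)))"
    proof (cases "t \<in> A")
      case True
      have "cmod (u t $ 1 * f t $ 1 + u t $ 2 * f t $ 2) \<le> norm (u t) * norm (f t)"
        by (rule norm_bilinear_form_le)
      also have "\<dots> \<le> D * exp (- \<kappa> * \<bar>t - x\<bar>) * norm (f t)"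
        by (intro mult_right_mono b True) auto
      finally show ?thesis using True by (simp add: mult.assoc)
    qed simp
  qed
qed

text \<open>Up to the common factor \<open>- 1 / W\<close>, \<open>P\<close> and \<open>Q\<close>
  are the coefficients of \<open>up\<close> and \<open>um\<close> in variation of constants. Each
  solution is integrated over the ray on which it decays.\<close>

private definition "P x = (LINT t:{x<..}|lebesgue. um t $ 1 * f t $ 1 + um t $ 2 * f t $ 2)"
private definition "Q x = (LINT t:{..x}|lebesgue. up t $ 1 * f t $ 1 + up t $ 2 * f t $ 2)"

private lemma P_integrable: "set_integrable lebesgue {x<..} (\<lambda>t. um t $ 1 * f t $ 1 + um t $ 2 * f t $ 2)"
proof (rule tail_integrable[OF dirac_ode_continuous[OF um_ode]])
  fix t assume "t \<in> {x<..}"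
  then have "exp (- \<kappa> * t) = exp (- \<kappa> * x) * exp (- \<kappa> * \<bar>t - x\<bar>)"
    by (simp add: exp_add[symmetric] algebra_simps)
  then show "norm (um t) \<le> (sup_norm pm * exp (- \<kappa> * x)) * exp (- \<kappa> * \<bar>t - x\<bar>)"
    using norm_um_le[of t] by (simp add: mult.assoc)
qed simp

private lemma Q_integrable: "set_integrable lebesgue {..x} (\<lambda>t. up t $ 1 * f t $ 1 + up t $ 2 * f t $ 2)"
proof (rule tail_integrable[OF dirac_ode_continuous[OF up_ode]])
  fix t assume "t \<in> {..x}"
  then have "exp (\<kappa> * t) = exp (\<kappa> * x) * exp (- \<kappa> * \<bar>t - x\<bar>)"
    by (simp add: exp_add[symmetric] algebra_simps)
  then show "norm (up t) \<le> (sup_norm pp * exp (\<kappa> * x)) * exp (- \<kappa> * \<bar>t - x\<bar>)"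
    using norm_up_le[of t] by (simp add: mult.assoc)
qed simp

text \<open>The integral is split at \<open>t = x\<close>. The diagonal, where \<open>green\<close>
  is set to 0 but belongs to the ray of \<open>Q\<close>, is a null set.\<close>

private lemma has_bochner_integral_green:
  "has_bochner_integral lebesgue (\<lambda>t. green \<Phi> k vp vm x t z *v f t) ((- P x / W) *s up x + (- Q x / W) *s um x)"
proof -
  let ?p = "\<lambda>t. indicator {x<..} t *\<^sub>R (um t $ 1 * f t $ 1 + um t $ 2 * f t $ 2)"
  let ?q = "\<lambda>t. indicator {..x} t *\<^sub>R (up t $ 1 * f t $ 1 + up t $ 2 * f t $ 2)"
  let ?F = "\<lambda>t. (- ?p t / W) *s up x + (- ?q t / W) *s um x"
  let ?G = "\<lambda>t. green \<Phi> k vp vm x t z *v f t"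
  have bl: "bounded_linear (\<lambda>c. (- c / W) *s v)" for v :: "complex ^ 2"
    by (auto simp: linear_conv_bounded_linear[symmetric] vec_eq_iff add_divide_distrib scaleR_conv_of_real[where 'a=complex] algebra_simps
        intro!: linearI)
  have p: "has_bochner_integral lebesgue ?p (P x)"
    using P_integrable[of x] by (simp add: has_bochner_integral_iff set_integrable_def P_def set_lebesgue_integral_def)
  have q: "has_bochner_integral lebesgue ?q (Q x)"
    using Q_integrable[of x] by (simp add: has_bochner_integral_iff set_integrable_def Q_def set_lebesgue_integral_def)
  have F: "has_bochner_integral lebesgue ?F ((- P x / W) *s up x + (- Q x / W) *s um x)"
    by (rule has_bochner_integral_add[OF has_bochner_integral_bounded_linear[OF bl p] has_bochner_integral_bounded_linear[OF bl q]])
  have ae: "AE t in lebesgue. ?F t = ?G t"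
    using AE_completion[OF AE_lborel_singleton[of x]]
  proof eventually_elim
    case (elim t)
    then consider "t > x" | "t < x" by linarith
    then show ?case
      by cases (simp_all add: green_gt green_lt)
  qed
  have FI: "integrable lebesgue ?F" using F by (simp only: has_bochner_integral_iff)
  have GI: "integrable lebesgue ?G" by (rule integrable_lebesgue_cong_AE[OF FI ae])
  have "integral\<^sup>L lebesgue ?F = integral\<^sup>L lebesgue ?G"
    by (rule integral_cong_AE[OF borel_measurable_integrable[OF FI] borel_measurable_integrable[OF GI] ae])
  then show ?thesis using F GI by (simp only: has_bochner_integral_iff)
qed

lemma green_integrable: "integrable lebesgue (\<lambda>t. green \<Phi> k vp vm x t z *v f t)"
  using has_bochner_integral_green by (rule integrable.intros)

lemma green_operator_ode: "dirac_ode m q z (green_operator \<Phi> k vp vm z f) f"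
proof -
  have T: "green_operator \<Phi> k vp vm z f = (\<lambda>x. (- P x / W) *s up x + (- Q x / W) *s um x)"
    unfolding green_operator_def using has_bochner_integral_green has_bochner_integral_integral_eq by fast
  have P: "has_ac_derivative P (\<lambda>t. - (um t $ 1 * f t $ 1 + um t $ 2 * f t $ 2))"
    unfolding P_def[abs_def] by (rule has_ac_derivative_upper_tail[OF P_integrable])
  have Q: "has_ac_derivative Q (\<lambda>t. up t $ 1 * f t $ 1 + up t $ 2 * f t $ 2)"
    unfolding Q_def[abs_def] by (rule has_ac_derivative_lower_tail[OF Q_integrable])
  \<comment> \<open>With this quotient the terms from the derivatives of \<open>P\<close> and
    \<open>Q\<close> reproduce one component of \<open>f\<close>, while the other component
    cancels.\<close>
  have Weq: "(up x $ 1 * um x $ 2 - um x $ 1 * up x $ 2) / W = 1" for x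
    using det_columns_up_um[of x] det_columns_vp_vm by (simp add: det_columns_eq)
  note up' = up_ode[unfolded dirac_ode_def zero_index add_0_right diff_0_right]
  note um' = um_ode[unfolded dirac_ode_def zero_index add_0_right diff_0_right]
  have comp: "green_operator \<Phi> k vp vm z f x $ i = (- 1 / W) * (P x * up x $ i + Q x * um x $ i)" for x i
    unfolding T by (simp add: field_simps add_divide_distrib)
  show ?thesis
    unfolding dirac_ode_def comp
  proof
    show "has_ac_derivative (\<lambda>x. (- 1 / W) * (P x * up x $ 1 + Q x * um x $ 1))
      (\<lambda>x. (z - of_real (q x) + of_real m) * ((- 1 / W) * (P x * up x $ 2 + Q x * um x $ 2)) + f x $ 2)"
    proof (rule has_ac_derivative_eq_rhs[OF has_ac_derivative_cmult[OF has_ac_derivative_add[OF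
            has_ac_derivative_mult[OF P up'[THEN conjunct1]] has_ac_derivative_mult[OF Q um'[THEN conjunct1]]]]])
      fix x
      let ?A = "z - of_real (q x) + of_real m"
      have "(- 1 / W) * (- (um x $ 1 * f x $ 1 + um x $ 2 * f x $ 2) * up x $ 1 + P x * (?A * up x $ 2) +
          ((up x $ 1 * f x $ 1 + up x $ 2 * f x $ 2) * um x $ 1 + Q x * (?A * um x $ 2)))
        = ?A * ((- 1 / W) * (P x * up x $ 2 + Q x * um x $ 2)) + (up x $ 1 * um x $ 2 - um x $ 1 * up x $ 2) / W * f x $ 2"
        using det_columns_vp_vm by (simp add: field_simps)
      then show "(- 1 / W) * (- (um x $ 1 * f x $ 1 + um x $ 2 * f x $ 2) * up x $ 1 + P x * (?A * up x $ 2) +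
          ((up x $ 1 * f x $ 1 + up x $ 2 * f x $ 2) * um x $ 1 + Q x * (?A * um x $ 2)))
        = ?A * ((- 1 / W) * (P x * up x $ 2 + Q x * um x $ 2)) + f x $ 2"
        unfolding Weq by simp
    qed
    show "has_ac_derivative (\<lambda>x. (- 1 / W) * (P x * up x $ 2 + Q x * um x $ 2))
      (\<lambda>x. (of_real m + of_real (q x) - z) * ((- 1 / W) * (P x * up x $ 1 + Q x * um x $ 1)) - f x $ 1)"
    proof (rule has_ac_derivative_eq_rhs[OF has_ac_derivative_cmult[OF has_ac_derivative_add[OF
            has_ac_derivative_mult[OF P up'[THEN conjunct2]] has_ac_derivative_mult[OF Q um'[THEN conjunct2]]]]])
      fix x
      let ?A = "of_real m + of_real (q x) - z"
      have "(- 1 / W) * (- (um x $ 1 * f x $ 1 + um x $ 2 * f x $ 2) * up x $ 2 + P x * (?A * up x $ 1) +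
          ((up x $ 1 * f x $ 1 + up x $ 2 * f x $ 2) * um x $ 2 + Q x * (?A * um x $ 1)))
        = ?A * ((- 1 / W) * (P x * up x $ 1 + Q x * um x $ 1)) - (up x $ 1 * um x $ 2 - um x $ 1 * up x $ 2) / W * f x $ 1"
        using det_columns_vp_vm by (simp add: field_simps)
      then show "(- 1 / W) * (- (um x $ 1 * f x $ 1 + um x $ 2 * f x $ 2) * up x $ 2 + P x * (?A * up x $ 1) +
          ((up x $ 1 * f x $ 1 + up x $ 2 * f x $ 2) * um x $ 2 + Q x * (?A * um x $ 1)))
        = ?A * ((- 1 / W) * (P x * up x $ 1 + Q x * um x $ 1)) - f x $ 1"
        unfolding Weq by simp
    qed
  qed
qed

lemma norm_green_operator_le:
  "norm (green_operator \<Phi> k vp vm z f x) \<le> C * (LINT t|lebesgue. exp (- \<kappa> * \<bar>t - x\<bar>) * norm (f t))"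
proof -
  have "norm (green_operator \<Phi> k vp vm z f x) \<le> (LINT t|lebesgue. norm (green \<Phi> k vp vm x t z *v f t))"
    unfolding green_operator_def by (rule integral_norm_bound)
  also have "\<dots> \<le> (LINT t|lebesgue. C * (exp (- \<kappa> * \<bar>t - x\<bar>) * norm (f t)))"
  proof (rule integral_mono_AE)
    show "AE t in lebesgue. norm (green \<Phi> k vp vm x t z *v f t) \<le> C * (exp (- \<kappa> * \<bar>t - x\<bar>) * norm (f t))"
      using AE_completion[OF AE_lborel_singleton[of x]] by eventually_elim (rule norm_green_mult_le)
  qed (use green_integrable Lp_exp_integrable in auto)
  finally show ?thesis by simp
qed

text \<open>Measurability in \<open>x\<close> is read off from the continuity of the solution rather
  than from joint measurability of the kernel.\<close>

lemma green_operator_measurable: "green_operator \<Phi> k vp vm z f \<in> borel_measurable lebesgue"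
  by (rule continuous_imp_lebesgue_measurable[OF dirac_ode_continuous[OF green_operator_ode]])

lemma green_operator_Lp: "green_operator \<Phi> k vp vm z f \<in> Lp_space r'"
  and Lp_norm_green_operator_le:
    "Lp_norm r' (green_operator \<Phi> k vp vm z f) \<le> C * (4 / (r' * \<kappa>)) powr (2 / r') * Lp_norm r f"
proof -
  note Y = Im_k_pos r norm_ge_zero norm_f_integrable
    measurable_compose[OF green_operator_measurable borel_measurable_norm] C_nonneg
  have b: "\<bar>norm (green_operator \<Phi> k vp vm z f x)\<bar> \<le> C * (LINT t|lebesgue. exp (- \<kappa> * \<bar>t - x\<bar>) * norm (f t))" for x
    using norm_green_operator_le by simp
  show "green_operator \<Phi> k vp vm z f \<in> Lp_space r'"
    using Young_exp_Lp[OF Y b] green_operator_measurable by (simp add: Lp_space_def)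
  show "Lp_norm r' (green_operator \<Phi> k vp vm z f) \<le> C * (4 / (r' * \<kappa>)) powr (2 / r') * Lp_norm r f"
    using Young_exp_norm[OF Y b] by (simp add: Lp_norm_def)
qed

end

end

section \<open>Resolvent and spectrum\<close>

lemma Lp_norm_nonneg: "Lp_norm p f \<ge> 0"
  by (simp add: Lp_norm_def)

context floquet_gap
begin

text \<open>The Wronskian of \<open>u\<close> with \<open>um\<close> is constant, yet for positive
  arguments it is dominated by an integrable function, namely a decaying exponential times the
  \<open>L^2\<close> function \<open>norm u\<close>. So it is 0; likewise with \<open>up\<close> for
  negative arguments.\<close>

lemma homogeneous_solution_eq_0:
  assumes u: "u \<in> Lp_space 2" and ode: "dirac_ode m q z u (\<lambda>_. 0)"
  shows "u x = 0"
proof -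
  have two: "1 < (2::real)" "(2::real) \<le> 2" "(2::real) = 1 / (1 - 1 / 2)" by simp_all
  have int: "integrable lebesgue (\<lambda>t. S * (exp (- \<kappa> * \<bar>t - 0\<bar>) * norm (u t)))" for S
    using Lp_exp_integrable[OF two u, of 0] by simp
  have minus: "det_columns (u x) (um x) = 0"
  proof -
    have "cmod (det_columns (u x) (um x)) \<le> 0"
    proof (rule lower_bound_integrable_imp_nonpos[OF int[of "sup_norm pm"]])
      show "0 \<le> sup_norm pm * (exp (- \<kappa> * \<bar>t - 0\<bar>) * norm (u t))" for t
        using sup_norms_nonneg by simp
      have "cmod (det_columns (u x) (um x)) \<le> sup_norm pm * (exp (- \<kappa> * \<bar>t - 0\<bar>) * norm (u t))" if "t \<ge> 0" for t
      proof -
        have "cmod (det_columns (u x) (um x)) = cmod (det_columns (u t) (um t))"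
          using det_columns_constant[OF ode um_ode, of x t] by simp
        also have "\<dots> \<le> norm (u t) * norm (um t)" by (rule cmod_det_columns_le)
        also have "\<dots> \<le> norm (u t) * (sup_norm pm * exp (- \<kappa> * t))"
          by (intro mult_left_mono norm_um_le) auto
        finally show ?thesis using that by (simp add: mult_ac)
      qed
      then show "\<exists>s. \<forall>t\<in>{s..s + real n}. cmod (det_columns (u x) (um x)) \<le> sup_norm pm * (exp (- \<kappa> * \<bar>t - 0\<bar>) * norm (u t))" for n
        by (intro exI[of _ 0]) auto
    qed
    then show ?thesis by simp
  qed
  have plus: "det_columns (u x) (up x) = 0"
  proof -
    have "cmod (det_columns (u x) (up x)) \<le> 0"
    proof (rule lower_bound_integrable_imp_nonpos[OF int[of "sup_norm pp"]])
      show "0 \<le> sup_norm pp * (exp (- \<kappa> * \<bar>t - 0\<bar>) * norm (u t))" for t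
        using sup_norms_nonneg by simp
      have "cmod (det_columns (u x) (up x)) \<le> sup_norm pp * (exp (- \<kappa> * \<bar>t - 0\<bar>) * norm (u t))" if "t \<le> 0" for t
      proof -
        have "cmod (det_columns (u x) (up x)) = cmod (det_columns (u t) (up t))"
          using det_columns_constant[OF ode up_ode, of x t] by simp
        also have "\<dots> \<le> norm (u t) * norm (up t)" by (rule cmod_det_columns_le)
        also have "\<dots> \<le> norm (u t) * (sup_norm pp * exp (\<kappa> * t))"
          by (intro mult_left_mono norm_up_le) auto
        finally show ?thesis using that by (simp add: mult_ac)
      qed
      \<comment> \<open>The window starts at \<open>- n\<close> so as to end at 0, since the
        estimate holds on the negative half-line.\<close>
      then show "\<exists>s. \<forall>t\<in>{s..s + real n}. cmod (det_columns (u x) (up x)) \<le> sup_norm pp * (exp (- \<kappa> * \<bar>t - 0\<bar>) * norm (u t))" for n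
        by (intro exI[of _ "- real n"]) auto
    qed
    then show ?thesis by simp
  qed
  show ?thesis
    by (rule det_columns_eq_0_imp_0[OF plus minus]) (simp add: det_columns_up_um det_columns_vp_vm)
qed

text \<open>Existence and uniqueness in one statement. The difference of two solutions vanishes at
  every point, so \<open>u\<close> is determined literally, as the unique existence in
  \<open>resolvent_set\<close> demands.\<close>

lemma dirac_graph_iff_green_operator:
  assumes f: "f \<in> Lp_space 2"
  shows "(u, \<lambda>x. f x + z *s u x) \<in> dirac_graph m q \<longleftrightarrow> u = green_operator \<Phi> k vp vm z f"
proof
  have two: "1 < (2::real)" "(2::real) \<le> 2" "(2::real) = 1 / (1 - 1 / 2)" by simp_all
  let ?T = "green_operator \<Phi> k vp vm z f"
  have T: "?T \<in> Lp_space 2" "dirac_ode m q z ?T f"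
    by (rule green_operator_Lp[OF two f], rule green_operator_ode[OF two f])
  show "(u, \<lambda>x. f x + z *s u x) \<in> dirac_graph m q" if "u = ?T"
    unfolding dirac_graph_iff_ode that
    by (intro conjI T Lp_space_add Lp_space_smult f) simp
  assume "(u, \<lambda>x. f x + z *s u x) \<in> dirac_graph m q"
  then have u: "u \<in> Lp_space 2" "dirac_ode m q z u f" unfolding dirac_graph_iff_ode by auto
  have "(\<lambda>x. u x + (- 1) *s ?T x) \<in> Lp_space 2"
    by (intro Lp_space_add Lp_space_smult T u) simp
  then have L: "(\<lambda>x. u x - ?T x) \<in> Lp_space 2" by simp
  have "dirac_ode m q z (\<lambda>x. u x - ?T x) (\<lambda>_. 0)"
    using dirac_ode_diff[OF u(2) T(2)] by simp
  from homogeneous_solution_eq_0[OF L this] show "u = ?T" by (intro ext) simp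
qed

lemma resolvent_eq_green_operator:
  "f \<in> Lp_space 2 \<Longrightarrow> resolvent (dirac_graph m q) z f = green_operator \<Phi> k vp vm z f"
  by (simp add: resolvent_def dirac_graph_iff_green_operator)

lemma in_resolvent_set: "z \<in> resolvent_set (dirac_graph m q)"
proof -
  have "1 < (2::real)" "(2::real) \<le> 2" "(2::real) = 1 / (1 - 1 / 2)" by simp_all
  from Lp_norm_green_operator_le[OF this]
  have "\<exists>D. \<forall>f \<in> Lp_space 2. Lp_norm 2 (green_operator \<Phi> k vp vm z f) \<le> D * Lp_norm 2 f" by blast
  then show ?thesis
    by (simp add: resolvent_set_def dirac_graph_iff_green_operator)
qed

text \<open>Since the integrals converge for every \<open>x\<close>, linearity and the independence
  of representatives are obtained at every point.\<close>

lemma green_operator_bounded_linear: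
  assumes r: "1 < r" "r \<le> 2" "r' = 1 / (1 - 1 / r)"
  shows "Lp_bounded_linear r r' (green_operator \<Phi> k vp vm z)"
  unfolding Lp_bounded_linear_def
proof (intro conjI ballI impI allI)
  fix f assume f: "f \<in> Lp_space r"
  show "green_operator \<Phi> k vp vm z f \<in> Lp_space r'" by (rule green_operator_Lp[OF r f])
  show "AE x in lebesgue. green_operator \<Phi> k vp vm z (\<lambda>y. c *s f y) x = c *s green_operator \<Phi> k vp vm z f x" for c
  proof (rule AE_I2)
    fix x
    have "(LINT t|lebesgue. c *s (green \<Phi> k vp vm x t z *v f t)) = c *s (LINT t|lebesgue. green \<Phi> k vp vm x t z *v f t)"
      by (rule integral_bounded_linear[OF bounded_linear_vector_smult green_integrable[OF r f]])
    then show "green_operator \<Phi> k vp vm z (\<lambda>y. c *s f y) x = c *s green_operator \<Phi> k vp vm z f x"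
      by (simp add: green_operator_def vector_scalar_commute)
  qed
  fix g assume g: "g \<in> Lp_space r"
  show "AE x in lebesgue. green_operator \<Phi> k vp vm z (\<lambda>y. f y + g y) x
      = green_operator \<Phi> k vp vm z f x + green_operator \<Phi> k vp vm z g x"
    by (intro AE_I2) (simp add: green_operator_def matrix_vector_right_distrib green_integrable[OF r] f g)
  assume ae: "AE x in lebesgue. f x = g x"
  show "AE x in lebesgue. green_operator \<Phi> k vp vm z f x = green_operator \<Phi> k vp vm z g x"
  proof (rule AE_I2)
    fix x
    have "AE t in lebesgue. green \<Phi> k vp vm x t z *v f t = green \<Phi> k vp vm x t z *v g t"
      using ae by eventually_elim simp
    then show "green_operator \<Phi> k vp vm z f x = green_operator \<Phi> k vp vm z g x"
      unfolding green_operator_def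
      by (rule integral_cong_AE[OF borel_measurable_integrable[OF green_integrable[OF r f]]
            borel_measurable_integrable[OF green_integrable[OF r g]]])
  qed
next
  show "\<exists>D. \<forall>f\<in>Lp_space r. Lp_norm r' (green_operator \<Phi> k vp vm z f) \<le> D * Lp_norm r f"
    using Lp_norm_green_operator_le[OF r] by blast
qed

lemma green_operator_opnorm_le:
  assumes r: "1 < r" "r \<le> 2" "r' = 1 / (1 - 1 / r)"
  shows "Lp_opnorm r r' (green_operator \<Phi> k vp vm z) \<le> C * (4 / (r' * \<kappa>)) powr (2 / r')"
  unfolding Lp_opnorm_def
proof (rule cSUP_least)
  \<comment> \<open>The supremum of an empty set would be unspecified; the zero function shows that
    the unit ball is inhabited.\<close>
  have "(\<lambda>_. 0) \<in> {f \<in> Lp_space r. Lp_norm r f \<le> 1}"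
    by (simp add: Lp_space_def Lp_norm_def)
  then show "{f \<in> Lp_space r. Lp_norm r f \<le> 1} \<noteq> {}" by blast
  fix f assume f: "f \<in> {f \<in> Lp_space r. Lp_norm r f \<le> 1}"
  then have "Lp_norm r' (green_operator \<Phi> k vp vm z f) \<le> C * (4 / (r' * \<kappa>)) powr (2 / r') * Lp_norm r f"
    by (intro Lp_norm_green_operator_le[OF r]) simp
  also have "\<dots> \<le> C * (4 / (r' * \<kappa>)) powr (2 / r') * 1"
    using f C_nonneg by (intro mult_left_mono) auto
  finally show "Lp_norm r' (green_operator \<Phi> k vp vm z f) \<le> C * (4 / (r' * \<kappa>)) powr (2 / r')" by simp
qed

end

section \<open>Approximate eigenfunctions on the spectrum\<close>

lemma Lp_space_mono:
  assumes f: "f \<in> Lp_space p" and g: "g \<in> borel_measurable lebesgue" and p: "p \<ge> 0"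
    and le: "\<And>x. norm (g x) \<le> norm (f x)"
  shows "g \<in> Lp_space p"
proof -
  have "integrable lebesgue (\<lambda>x. norm (g x) powr p)"
  proof (rule Bochner_Integration.integrable_bound)
    show "integrable lebesgue (\<lambda>x. norm (f x) powr p)" using f by (simp add: Lp_space_def)
    show "(\<lambda>x. norm (g x) powr p) \<in> borel_measurable lebesgue"
      using measurable_compose[OF g borel_measurable_norm] by measurable
    show "AE x in lebesgue. norm (norm (g x) powr p) \<le> norm (norm (f x) powr p)"
      using le p by (intro AE_I2) (simp add: powr_mono2)
  qed
  with g show ?thesis by (simp add: Lp_space_def)
qed

lemma Lp_norm_mono:
  assumes f: "f \<in> Lp_space p" and g: "g \<in> Lp_space p" and p: "p > 0" and c: "c \<ge> 0"
    and le: "\<And>x. norm (g x) \<le> c * norm (f x)"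
  shows "Lp_norm p g \<le> c * Lp_norm p f"
proof -
  have "(LINT x|lebesgue. norm (g x) powr p) \<le> (LINT x|lebesgue. c powr p * norm (f x) powr p)"
  proof (rule integral_mono)
    show "integrable lebesgue (\<lambda>x. norm (g x) powr p)" "integrable lebesgue (\<lambda>x. c powr p * norm (f x) powr p)"
      using f g by (simp_all add: Lp_space_def)
    show "norm (g x) powr p \<le> c powr p * norm (f x) powr p" for x
      using powr_mono2[OF _ _ le[of x], of p] p c by (simp add: powr_mult)
  qed
  then have "Lp_norm p g \<le> (c powr p * (LINT x|lebesgue. norm (f x) powr p)) powr (1 / p)"
    unfolding Lp_norm_def using p by (intro powr_mono2) auto
  also have "\<dots> = c * Lp_norm p f"
    using p c by (simp add: Lp_norm_def powr_mult powr_powr)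
  finally show ?thesis .
qed

lemma Lp_norm_pos:
  assumes f: "f \<in> Lp_space p" and nz: "\<And>x. f x \<noteq> 0"
  shows "Lp_norm p f > 0"
proof -
  have i: "integrable lebesgue (\<lambda>x. norm (f x) powr p)" using f by (simp add: Lp_space_def)
  have "(LINT x|lebesgue. norm (f x) powr p) \<noteq> 0"
  proof
    assume "(LINT x|lebesgue. norm (f x) powr p) = 0"
    then have "AE x in lebesgue. norm (f x) powr p = 0"
      using integral_nonneg_eq_0_iff_AE[OF i] by simp
    then have "AE x :: real in lebesgue. False"
      using nz by simp
    then have "emeasure lebesgue (UNIV :: real set) = 0"
      by (simp add: AE_iff_measurable[where N=UNIV])
    then show False by simp
  qed
  then have "(LINT x|lebesgue. norm (f x) powr p) > 0"
    by (smt (verit) integral_nonneg_AE AE_I2 powr_ge_zero)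
  then show ?thesis by (simp add: Lp_norm_def)
qed

context floquet
begin

text \<open>
  If \<open>Im k = 0\<close>, the Floquet solution is bounded, and \<open>\<eta> u\<^sub>+\<close> with \<open>\<eta> = 1 / cosh (e \<cdot>)\<close>
  is an approximate eigenfunction because \<open>\<bar>\<eta>'\<bar> \<le> e \<eta>\<close>.
\<close>

lemma not_in_resolvent_set:
  assumes k0: "\<kappa> = 0"
  shows "z \<notin> resolvent_set (dirac_graph m q)"
proof
  assume "z \<in> resolvent_set (dirac_graph m q)"
  then obtain D where D: "\<And>f u. f \<in> Lp_space 2 \<Longrightarrow> (u, \<lambda>x. f x + z *s u x) \<in> dirac_graph m q \<Longrightarrow> Lp_norm 2 u \<le> D * Lp_norm 2 f"
    unfolding resolvent_set_def by blast
  \<comment> \<open>This choice makes the product of the supposed resolvent bound and the relative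
    error \<open>e\<close> smaller than 1.\<close>
  define e where "e = 1 / (\<bar>D\<bar> + 1)"
  have e: "e > 0" "\<bar>D\<bar> * e < 1" unfolding e_def by (simp_all add: field_simps)
  define \<eta> where "\<eta> = (\<lambda>x. 1 / cosh (e * x))"
  define \<eta>' where "\<eta>' = (\<lambda>x. - e * sinh (e * x) / (cosh (e * x))\<^sup>2)"
  have deriv: "(\<eta> has_real_derivative \<eta>' x) (at x)" for x
    unfolding \<eta>_def \<eta>'_def
    by (rule derivative_eq_intros refl | simp add: power2_eq_square)+
  have cont: "continuous_on UNIV \<eta>" "continuous_on UNIV \<eta>'"
    unfolding \<eta>_def \<eta>'_def by (intro continuous_intros; simp)+
  have \<eta>_ac: "has_ac_derivative (\<lambda>x. complex_of_real (\<eta> x)) (\<lambda>x. complex_of_real (\<eta>' x))"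
    by (rule has_ac_derivative_bounded_linear[OF has_ac_derivative_C1 bounded_linear_of_real])
       (use deriv cont in \<open>auto simp: has_real_derivative_iff_has_vector_derivative\<close>)
  have \<eta>_pos: "\<eta> x > 0" for x unfolding \<eta>_def by simp
  have \<eta>'_le: "\<bar>\<eta>' x\<bar> \<le> e * \<eta> x" for x
  proof -
    have "\<bar>sinh (e * x)\<bar> \<le> cosh (e * x)"
      by (simp add: sinh_field_def cosh_field_def abs_le_iff field_simps)
    then have "e * \<bar>sinh (e * x)\<bar> / (cosh (e * x))\<^sup>2 \<le> e * cosh (e * x) / (cosh (e * x))\<^sup>2"
      using e by (intro divide_right_mono mult_left_mono) auto
    then show ?thesis
      unfolding \<eta>_def \<eta>'_def using e by (simp add: abs_mult power2_eq_square)
  qed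
  \<comment> \<open>Exponential decay of the cutoff makes the merely bounded solution square
    integrable.\<close>
  have \<eta>_le: "\<eta> x \<le> 2 * exp (- e * \<bar>x\<bar>)" for x
  proof -
    have "exp \<bar>e * x\<bar> / 2 \<le> cosh (e * x)" by (auto simp: cosh_def abs_if)
    then have "1 / cosh (e * x) \<le> 1 / (exp \<bar>e * x\<bar> / 2)"
      by (intro divide_left_mono) auto
    then show ?thesis unfolding \<eta>_def using e by (simp add: abs_mult exp_minus field_simps)
  qed
  let ?S = "sup_norm pp"
  have up_le: "norm (up x) \<le> ?S" for x using norm_up_le[of x] k0 by simp
  have up_nz: "up x \<noteq> 0" for x
  proof
    assume "up x = 0"
    have "det (\<Phi> x z) \<noteq> 0" by (simp add: det_fundamental_system[OF fundamental])
    then have "invertible (\<Phi> x z)" by (simp add: invertible_det_nz)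
    then have "vp = 0" using \<open>up x = 0\<close> by (metis invertible_def matrix_vector_mul_assoc matrix_vector_mul_lid matrix_vector_mult_0_right)
    then show False using eigenvector_plus by (simp add: is_eigenvector_def)
  qed
  let ?u = "\<lambda>x. complex_of_real (\<eta> x) *s up x"
  \<comment> \<open>Only the differentiated cutoff survives in
    \<open>(H\<^sub>0 - z) (\<eta> up)\<close>, and \<open>- \<i> sigma2\<close> turns
    \<open>\<eta>' up\<close> into this vector.\<close>
  let ?f = "\<lambda>x. complex_of_real (\<eta>' x) *s vector [- (up x $ 2), up x $ 1] :: complex ^ 2"
  have norm_u: "norm (?u x) = \<eta> x * norm (up x)" for x
    using \<eta>_pos[of x] by (simp add: norm_vector_smult)
  have norm_f: "norm (?f x) = \<bar>\<eta>' x\<bar> * norm (up x)" for x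
  proof -
    have "norm (vector [- (up x $ 2), up x $ 1] :: complex ^ 2) = norm (up x)"
      by (simp add: norm_vec2_complex add.commute)
    then show ?thesis by (simp only: norm_vector_smult norm_of_real)
  qed
  note up_cont = dirac_ode_continuous[OF up_ode]
  have u_meas: "?u \<in> borel_measurable lebesgue"
    by (rule continuous_imp_lebesgue_measurable[OF continuous_on_smult[OF continuous_on_of_real[OF cont(1)] up_cont]])
  have "bounded_linear (\<lambda>v :: complex ^ 2. vector [- (v $ 2), v $ 1] :: complex ^ 2)"
    by (auto simp: linear_conv_bounded_linear[symmetric] vec_eq_iff forall_2 intro!: linearI)
  from bounded_linear.continuous_on[OF this up_cont]
  have f_meas: "?f \<in> borel_measurable lebesgue"
    by (rule continuous_imp_lebesgue_measurable[OF continuous_on_smult[OF continuous_on_of_real[OF cont(2)]]])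
  have u_L: "?u \<in> Lp_space 2"
  proof -
    have "integrable lebesgue (\<lambda>x. norm (?u x) powr 2)"
    proof (rule Bochner_Integration.integrable_bound)
      show "integrable lebesgue (\<lambda>x. (2 * ?S)\<^sup>2 * exp (- (2 * e) * \<bar>0 - x\<bar>))"
        using has_bochner_integral_exp_abs[of "2 * e" 0] e by (simp add: has_bochner_integral_iff)
      show "(\<lambda>x. norm (?u x) powr 2) \<in> borel_measurable lebesgue"
        using measurable_compose[OF u_meas borel_measurable_norm] by measurable
      have "norm (?u x) powr 2 \<le> (2 * ?S)\<^sup>2 * exp (- (2 * e) * \<bar>0 - x\<bar>)" for x
      proof -
        have "norm (?u x) \<le> (2 * exp (- e * \<bar>x\<bar>)) * ?S"
          unfolding norm_u using \<eta>_pos[of x] by (intro mult_mono \<eta>_le up_le) auto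
        then have "norm (?u x) ^ 2 \<le> ((2 * exp (- e * \<bar>x\<bar>)) * ?S) ^ 2"
          by (rule power_mono) simp
        also have "\<dots> = (2 * ?S)\<^sup>2 * exp (- (2 * e) * \<bar>0 - x\<bar>)"
          by (simp add: power_mult_distrib exp_double[symmetric] mult_ac)
        finally show ?thesis by simp
      qed
      then show "AE x in lebesgue. norm (norm (?u x) powr 2) \<le> norm ((2 * ?S)\<^sup>2 * exp (- (2 * e) * \<bar>0 - x\<bar>))"
        by (intro AE_I2) simp
    qed
    with u_meas show ?thesis by (simp add: Lp_space_def)
  qed
  have f_le: "norm (?f x) \<le> e * norm (?u x)" for x
    unfolding norm_f norm_u using mult_right_mono[OF \<eta>'_le[of x] norm_ge_zero[of "up x"]] by (simp add: mult.assoc)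
  have f_L: "?f \<in> Lp_space 2"
  proof (rule Lp_space_mono[OF Lp_space_smult[OF u_L, of "complex_of_real e"] f_meas])
    show "norm (?f x) \<le> norm (complex_of_real e *s ?u x)" for x
      using f_le[of x] e by (simp only: norm_vector_smult[of "complex_of_real e"] norm_of_real abs_of_pos)
  qed simp
  note up' = up_ode[unfolded dirac_ode_def zero_index add_0_right diff_0_right]
  have "dirac_ode m q z ?u ?f"
    unfolding dirac_ode_def vector_smult_component vector_2
    by (intro conjI; rule has_ac_derivative_eq_rhs)
       (rule has_ac_derivative_mult[OF \<eta>_ac up'[THEN conjunct1]] has_ac_derivative_mult[OF \<eta>_ac up'[THEN conjunct2]],
         simp add: algebra_simps)+
  then have "(?u, \<lambda>x. ?f x + z *s ?u x) \<in> dirac_graph m q"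
    unfolding dirac_graph_iff_ode by (intro conjI u_L Lp_space_add f_L Lp_space_smult) simp_all
  \<comment> \<open>The error is at most \<open>e\<close> times \<open>?u\<close> in norm, so the
    bound would give \<open>?u\<close> a norm smaller than itself; the norm is positive because
    neither \<open>\<eta>\<close> nor \<open>up\<close> has a zero.\<close>
  from D[OF f_L this] have "Lp_norm 2 ?u \<le> D * Lp_norm 2 ?f" .
  also have "\<dots> \<le> \<bar>D\<bar> * Lp_norm 2 ?f"
    using Lp_norm_nonneg by (intro mult_right_mono) auto
  also have "\<dots> \<le> \<bar>D\<bar> * (e * Lp_norm 2 ?u)"
    using e by (intro mult_left_mono Lp_norm_mono[OF u_L f_L _ _ f_le]) auto
  finally have "1 * Lp_norm 2 ?u \<le> (\<bar>D\<bar> * e) * Lp_norm 2 ?u" by (simp only: mult_1 mult.assoc)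
  moreover have "Lp_norm 2 ?u > 0"
    by (rule Lp_norm_pos[OF u_L]) (use up_nz \<eta>_pos in \<open>auto simp: vector_mul_eq_0 less_imp_neq[symmetric]\<close>)
  ultimately show False using e(2) by (simp only: mult_le_cancel_right_pos)
qed

text \<open>The trace is computed from the eigenvalue \<open>exp (- \<i> k a)\<close> and its
  inverse, which gives \<open>2 cos (k a)\<close> in the upper and the lower half-plane
  alike.\<close>

lemma discriminant_in_segment_iff:
  "discriminant a \<Phi> z \<in> complex_of_real ` {-2..2} \<longleftrightarrow> \<kappa> = 0"
proof -
  have "discriminant a \<Phi> z = exp (- \<i> * k z * of_real a) + 1 / exp (- \<i> * k z * of_real a)"
    unfolding discriminant_def
    by (rule trace_eq_of_eigenvector[OF eigenvector_plus])
       (simp_all add: monodromy_def det_fundamental_system[OF fundamental])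
  also have "\<dots> = 2 * cos (k z * of_real a)"
    by (simp add: cos_exp_eq exp_minus field_simps)
  finally show ?thesis
    using a_pos by (simp only: cos_in_real_segment_iff) simp
qed

end

theorem theorem1:
  fixes m a :: real
    and q :: "real \<Rightarrow> real"
    and \<Phi> :: "real \<Rightarrow> complex \<Rightarrow> complex ^ 2 ^ 2"
    and k :: "complex \<Rightarrow> complex"
    and z :: complex
    and vp vm :: "complex ^ 2"
  assumes "m \<ge> 0" and "a > 0"
    and "locally_integrable q" and "\<And>x. q (x + a) = q x"
    and "is_fundamental_system m q \<Phi>"
    and "is_quasimomentum a \<Phi> k"
    and "is_eigenvector (monodromy a \<Phi> z) (exp (- \<i> * k z * of_real a)) vp"
    and "is_eigenvector (monodromy a \<Phi> z) (exp (\<i> * k z * of_real a)) vm"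
  shows
    "(z \<in> resolvent_set (dirac_graph m q) \<longleftrightarrow> discriminant a \<Phi> z \<notin> complex_of_real ` {-2..2}) \<and>
     (z \<in> resolvent_set (dirac_graph m q) \<longrightarrow>
       (\<forall>f \<in> Lp_space 2. \<forall>x.
          integrable lebesgue (\<lambda>t. green \<Phi> k vp vm x t z *v f t) \<and>
          resolvent (dirac_graph m q) z f x = (LINT t|lebesgue. green \<Phi> k vp vm x t z *v f t)) \<and>
       (\<forall>x t. x \<noteq> t \<longrightarrow>
          frobenius_norm (green \<Phi> k vp vm x t z) =
            exp (- Im (k z) * \<bar>t - x\<bar>) / cmod (det_columns vp vm) *
            (if t > x then norm (phi_plus \<Phi> k vp x z) * norm (phi_minus \<Phi> k vm t z)
             else norm (phi_minus \<Phi> k vm x z) * norm (phi_plus \<Phi> k vp t z))) \<and>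
       (\<forall>r r'. 1 < r \<and> r \<le> 2 \<and> r' = 1 / (1 - 1 / r) \<longrightarrow>
          (\<forall>f \<in> Lp_space r. \<forall>x. integrable lebesgue (\<lambda>t. green \<Phi> k vp vm x t z *v f t)) \<and>
          Lp_bounded_linear r r' (green_operator \<Phi> k vp vm z) \<and>
          Lp_opnorm r r' (green_operator \<Phi> k vp vm z) \<le>
            sup_norm (\<lambda>x. phi_plus \<Phi> k vp x z) * sup_norm (\<lambda>x. phi_minus \<Phi> k vm x z) /
              cmod (det_columns vp vm) *
            (4 / (r' * Im (k z))) powr (2 / r')))"
proof -
  interpret floquet m a q \<Phi> k z vp vm
    by unfold_locales (rule assms)+
  have "Im (k z) \<ge> 0"
  proof (cases "Im z \<ge> 0")
    case True
    then show ?thesis using assms(6) by (simp add: is_quasimomentum_def)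
  next
    case False
    \<comment> \<open>The map \<open>w \<mapsto> - cnj w\<close> preserves imaginary parts, so the
      sign carries over to the lower half-plane.\<close>
    then have "k z = - cnj (k (cnj z))" "Im (k (cnj z)) \<ge> 0"
      using assms(6) by (simp_all add: is_quasimomentum_def)
    then show ?thesis by simp
  qed
  show ?thesis
  proof (cases "Im (k z) = 0")
    case True
    \<comment> \<open>Here \<open>z\<close> is outside the resolvent set and the discriminant lies
      in the segment: the equivalence holds and the remaining claims are vacuous.\<close>
    then show ?thesis
      using not_in_resolvent_set discriminant_in_segment_iff by simp
  next
    case False
    with \<open>Im (k z) \<ge> 0\<close> interpret floquet_gap m a q \<Phi> k z vp vm
      by unfold_locales simp
    have two: "1 < (2::real)" "(2::real) \<le> 2" "(2::real) = 1 / (1 - 1 / 2)" by simp_all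
    show ?thesis
    proof (intro conjI impI ballI allI)
      show "z \<in> resolvent_set (dirac_graph m q) \<longleftrightarrow> discriminant a \<Phi> z \<notin> complex_of_real ` {-2..2}"
        using in_resolvent_set discriminant_in_segment_iff False by simp
      show "integrable lebesgue (\<lambda>t. green \<Phi> k vp vm x t z *v f t)" if "f \<in> Lp_space 2" for f x
        by (rule green_integrable[OF two that])
      show "resolvent (dirac_graph m q) z f x = (LINT t|lebesgue. green \<Phi> k vp vm x t z *v f t)" if "f \<in> Lp_space 2" for f x
        using resolvent_eq_green_operator[OF that] by (simp add: green_operator_def)
      show "frobenius_norm (green \<Phi> k vp vm x t z) =
            exp (- Im (k z) * \<bar>t - x\<bar>) / cmod (det_columns vp vm) *
            (if t > x then norm (phi_plus \<Phi> k vp x z) * norm (phi_minus \<Phi> k vm t z)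
             else norm (phi_minus \<Phi> k vm x z) * norm (phi_plus \<Phi> k vp t z))" if "x \<noteq> t" for x t
        using that green_gt(2)[of x t] green_lt(2)[of t x] by (cases "t > x") simp_all
      fix r r' :: real assume r: "1 < r \<and> r \<le> 2 \<and> r' = 1 / (1 - 1 / r)"
      then have r: "1 < r" "r \<le> 2" "r' = 1 / (1 - 1 / r)" by auto
      show "integrable lebesgue (\<lambda>t. green \<Phi> k vp vm x t z *v f t)" if "f \<in> Lp_space r" for f x
        by (rule green_integrable[OF r that])
      show "Lp_bounded_linear r r' (green_operator \<Phi> k vp vm z)"
        by (rule green_operator_bounded_linear[OF r])
      show "Lp_opnorm r r' (green_operator \<Phi> k vp vm z) \<le>
            sup_norm (\<lambda>x. phi_plus \<Phi> k vp x z) * sup_norm (\<lambda>x. phi_minus \<Phi> k vm x z) /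
              cmod (det_columns vp vm) * (4 / (r' * Im (k z))) powr (2 / r')"
        using green_operator_opnorm_le[OF r] unfolding C_def .
    qed
  qed
qed

end
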